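(* Let $(\mathsf{A},\Delta)$ be a finite quantum group with Haar state $h$. For $f\in \mathsf{A}$ let $\omega_{f,f}:\mathsf{A}\to\mathbb{C}$ be the functional $\omega_{f,f}(a)=\langle f,af\rangle=h(f^*af)$. Then the map $f\mapsto\omega_{f,f}$ defines an order-preserving bijection between the set of pre-subgroups of $(\mathsf{A},\Delta)$ (with the order $g\prec f$ if and only if $V(f\otimes g)=f\otimes g$) and the set of idempotent states on $(\mathsf{A},\Delta)$ (with the order $\phi_1\prec\phi_2$ if and only if $\phi_1\star\phi_2=\phi_2$).
   Context: A compact quantum group is a pair $(\mathsf{A},\Delta)$ of a unital C*-algebra $\mathsf{A}$ and a unital $*$-homomorphism $\Delta:\mathsf{A}\to\mathsf{A}\otimes\mathsf{A}$ (minimal tensor product) with $(\mathrm{id}\otimes\Delta)\circ\Delta=(\Delta\otimes\mathrm{id})\circ\Delta$ and such that $\mathrm{span}\{\Delta(b)(\mathbf{1}\otimes a);a,b\in\mathsf{A}\}$ and $\mathrm{span}\{\Delta(b)(a\otimes\mathbf{1});a,b\in\mathsf{A}\}$ are dense in $\mathsf{A}\otimes\mathsf{A}$. It is a finite quantum group if $\mathsf{A}$ is finite-dimensional; then it has a counit, i.e. a character $\varepsilon:\mathsf{A}\to\mathbb{C}$ with $(\varepsilon\otimes\mathrm{id})\circ\Delta=(\mathrm{id}\otimes\varepsilon)\circ\Delta=\mathrm{id}$. The Haar state is the unique state $h$ with $(\mathrm{id}\otimes h)\circ\Delta(a)=h(a)\mathbf{1}=(h\otimes\mathrm{id})\circ\Delta(a)$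 for all $a\in\mathsf{A}$; in the finite case $h$ is a faithful trace. Let $H=L^2(\mathsf{A},h)$ be the GNS Hilbert space, with inner product $\langle u,v\rangle=h(u^*v)$ (linear in the second variable); in the finite case $H$ is identified with $\mathsf{A}$ as a vector space via $a\mapsto a\mathbf{1}_h$, where $\mathbf{1}_h$ is the cyclic vector. The multiplicative unitary is the unitary $V:H\otimes H\to H\otimes H$ determined by $V(a\otimes b)=\Delta(a)(\mathbf{1}\otimes b)$ for $a,b\in\mathsf{A}$. A pre-subgroup of a finite quantum group $(\mathsf{A},\Delta)$ is a unit vector $f\in H$ (equivalently, an element $f\in\mathsf{A}$ with $h(f^*f)=1$) such that $\varepsilon(f)>0$ and $V(f\otimes f)=f\otimes f$. The convolution of linear functionals $\psi_1,\psi_2:\mathsf{A}\to\mathbb{C}$ is $\psi_1\star\psi_2=(\psi_1\otimes\psi_2)\circ\Delta$. A state $\phi$ on $\mathsf{A}$ is idempotent if $\phi\star\phi=\phi$. *)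

theory Defs
  imports "HOL-Analysis.Analysis" "HOL-Library.Poly_Mapping" "HOL-Library.Complex_Order"
begin

section \<open>Complex vector spaces, *-algebras and C*-algebras\<close>

class scaleC =
  fixes scaleC :: "complex \<Rightarrow> 'a \<Rightarrow> 'a" (infixr \<open>*\<^sub>C\<close> 75)

class complex_vector = scaleC + ab_group_add +
  assumes scaleC_add_right: "c *\<^sub>C (x + y) = c *\<^sub>C x + c *\<^sub>C y"
    and scaleC_add_left: "(c + d) *\<^sub>C x = c *\<^sub>C x + d *\<^sub>C x"
    and scaleC_scaleC [simp]: "c *\<^sub>C d *\<^sub>C x = (c * d) *\<^sub>C x"
    and scaleC_one [simp]: "1 *\<^sub>C x = x"

global_interpretation complex_vector: vector_space "scaleC :: complex \<Rightarrow> 'a::complex_vector \<Rightarrow> 'a"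
  by unfold_locales (auto simp: scaleC_add_right scaleC_add_left)

abbreviation clinear :: "('a::complex_vector \<Rightarrow> 'b::complex_vector) \<Rightarrow> bool"
  where "clinear \<equiv> Vector_Spaces.linear scaleC scaleC"

class complex_algebra_1 = complex_vector + ring_1 +
  assumes mult_scaleC_left [simp]: "(c *\<^sub>C x) * y = c *\<^sub>C (x * y)"
    and mult_scaleC_right [simp]: "x * (c *\<^sub>C y) = c *\<^sub>C (x * y)"

class star_algebra = complex_algebra_1 +
  fixes star :: "'a \<Rightarrow> 'a"
  assumes star_star [simp]: "star (star x) = x"
    and star_add: "star (x + y) = star x + star y"
    and star_scaleC: "star (c *\<^sub>C x) = cnj c *\<^sub>C star x"
    and star_mult: "star (x * y) = star y * star x"

text \<open>Unital C*-algebras. The axiom \<open>norm 1 = 1\<close> of \<^class>\<open>real_normed_algebra_1\<close> only excludes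
  the zero algebra, on which there are no states.\<close>

class cstar_algebra = star_algebra + real_normed_algebra_1 + banach +
  assumes scaleR_scaleC: "r *\<^sub>R x = complex_of_real r *\<^sub>C x"
    and norm_scaleC: "norm (c *\<^sub>C x) = cmod c * norm x"
    and cstar_identity: "norm (star x * x) = (norm x)\<^sup>2"

instantiation complex :: cstar_algebra
begin

definition scaleC_complex :: "complex \<Rightarrow> complex \<Rightarrow> complex"
  where "scaleC_complex = (*)"

definition star_complex :: "complex \<Rightarrow> complex"
  where "star_complex = cnj"

instance
  by standard (auto simp: scaleC_complex_def star_complex_def algebra_simps norm_mult
      power2_eq_square scaleR_conv_of_real)

end

definition star_hom :: "('a::star_algebra \<Rightarrow> 'b::star_algebra) \<Rightarrow> bool"
  where "star_hom f \<longleftrightarrow> clinear f \<and> (\<forall>x y. f (x * y) = f x * f y) \<and> f 1 = 1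
    \<and> (\<forall>x. f (star x) = star (f x))"


section \<open>The algebraic tensor product\<close>

instantiation poly_mapping :: (type, complex_vector) complex_vector
begin

lift_definition scaleC_poly_mapping :: "complex \<Rightarrow> ('a \<Rightarrow>\<^sub>0 'b) \<Rightarrow> 'a \<Rightarrow>\<^sub>0 'b"
  is "\<lambda>c p x. c *\<^sub>C p x"
  subgoal for c p by (rule finite_subset[of _ "{x. p x \<noteq> 0}"]) auto
  done

instance
  by standard (transfer; simp add: scaleC_add_right scaleC_add_left)+

end

text \<open>The space \<open>V \<otimes> W\<close> is the quotient of the free vector space on \<open>V \<times> W\<close>
  by the span of the bilinearity relations.\<close>

inductive_set tensor_relations :: "('a::complex_vector \<times> 'b::complex_vector \<Rightarrow>\<^sub>0 complex) set"
  where
    add_left: "Poly_Mapping.single (a + a', b) 1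
      - (Poly_Mapping.single (a, b) 1 + Poly_Mapping.single (a', b) 1) \<in> tensor_relations"
  | add_right: "Poly_Mapping.single (a, b + b') 1
      - (Poly_Mapping.single (a, b) 1 + Poly_Mapping.single (a, b') 1) \<in> tensor_relations"
  | scale_left: "Poly_Mapping.single (c *\<^sub>C a, b) 1
      - c *\<^sub>C Poly_Mapping.single (a, b) 1 \<in> tensor_relations"
  | scale_right: "Poly_Mapping.single (a, c *\<^sub>C b) 1
      - c *\<^sub>C Poly_Mapping.single (a, b) 1 \<in> tensor_relations"

definition tensor_rel ::
    "('a::complex_vector \<times> 'b::complex_vector \<Rightarrow>\<^sub>0 complex) \<Rightarrow> ('a \<times> 'b \<Rightarrow>\<^sub>0 complex) \<Rightarrow> bool"
  where "tensor_rel p q \<longleftrightarrow> p - q \<in> complex_vector.span tensor_relations"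

quotient_type (overloaded) ('a, 'b) tensor =
  "('a::complex_vector \<times> 'b::complex_vector) \<Rightarrow>\<^sub>0 complex" / tensor_rel
proof (rule equivpI)
  show "reflp tensor_rel"
    by (auto simp: reflp_def tensor_rel_def complex_vector.span_zero)
  show "symp tensor_rel"
    by (auto simp: symp_def tensor_rel_def)
       (metis complex_vector.span_neg minus_diff_eq)
  show "transp tensor_rel"
    by (auto simp: transp_def tensor_rel_def)
       (metis (no_types, opaque_lifting) complex_vector.span_add diff_add_cancel diff_diff_eq2 add_diff_eq)
qed

instantiation tensor :: (complex_vector, complex_vector) complex_vector
begin

lift_definition zero_tensor :: "('a, 'b) tensor" is 0 .

lift_definition plus_tensor :: "('a, 'b) tensor \<Rightarrow> ('a, 'b) tensor \<Rightarrow> ('a, 'b) tensor" is "(+)"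
  subgoal for p p' q q'
    using complex_vector.span_add[of "p - p'" tensor_relations "q - q'"]
    by (simp add: tensor_rel_def algebra_simps)
  done

lift_definition uminus_tensor :: "('a, 'b) tensor \<Rightarrow> ('a, 'b) tensor" is uminus
  subgoal for p p'
    using complex_vector.span_neg[of "p - p'" tensor_relations]
    by (simp add: tensor_rel_def algebra_simps)
  done

lift_definition minus_tensor :: "('a, 'b) tensor \<Rightarrow> ('a, 'b) tensor \<Rightarrow> ('a, 'b) tensor" is "(-)"
  subgoal for p p' q q'
    using complex_vector.span_diff[of "p - p'" tensor_relations "q - q'"]
    by (simp add: tensor_rel_def algebra_simps)
  done

lift_definition scaleC_tensor :: "complex \<Rightarrow> ('a, 'b) tensor \<Rightarrow> ('a, 'b) tensor" is scaleC
  subgoal for c p p'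
    using complex_vector.span_scale[of "p - p'" tensor_relations c]
    by (simp add: tensor_rel_def complex_vector.scale_right_diff_distrib)
  done

instance
  by standard
     (transfer; simp add: tensor_rel_def complex_vector.span_zero algebra_simps
        scaleC_add_right scaleC_add_left)+

end

lift_definition elem_tensor :: "'a::complex_vector \<Rightarrow> 'b::complex_vector \<Rightarrow> ('a, 'b) tensor"
    (infixr \<open>\<otimes>\<close> 75)
  is "\<lambda>a b. Poly_Mapping.single (a, b) 1" .

lemma elem_tensor_add_left: "(a + a') \<otimes> b = a \<otimes> b + a' \<otimes> b"
  by transfer (unfold tensor_rel_def, rule complex_vector.span_base, rule tensor_relations.add_left)

lemma elem_tensor_add_right: "a \<otimes> (b + b') = a \<otimes> b + a \<otimes> b'"
  by transfer (unfold tensor_rel_def, rule complex_vector.span_base, rule tensor_relations.add_right)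

lemma elem_tensor_scaleC_left: "(c *\<^sub>C a) \<otimes> b = c *\<^sub>C (a \<otimes> b)"
  by transfer (unfold tensor_rel_def, rule complex_vector.span_base, rule tensor_relations.scale_left)

lemma elem_tensor_scaleC_right: "a \<otimes> (c *\<^sub>C b) = c *\<^sub>C (a \<otimes> b)"
  by transfer (unfold tensor_rel_def, rule complex_vector.span_base, rule tensor_relations.scale_right)

lemma elem_tensor_zero_left [simp]: "0 \<otimes> b = 0"
  using elem_tensor_add_left[of 0 0 b] by simp

lemma elem_tensor_zero_right [simp]: "a \<otimes> 0 = 0"
  using elem_tensor_add_right[of a 0 0] by simp

lemma free_vector_induct:
  assumes "\<And>x c. P (Poly_Mapping.single x c)" and "\<And>p q. P p \<Longrightarrow> P q \<Longrightarrow> P (p + q)"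
  shows "P (p :: 'x \<Rightarrow>\<^sub>0 complex)"
proof (induction "card (Poly_Mapping.keys p)" arbitrary: p)
  case 0
  then have "p = 0" by simp
  then show ?case using assms(1)[of undefined 0] by simp
next
  case (Suc n)
  then obtain x where x: "x \<in> Poly_Mapping.keys p" by fastforce
  define q where "q = p - Poly_Mapping.single x (Poly_Mapping.lookup p x)"
  have "Poly_Mapping.keys q = Poly_Mapping.keys p - {x}"
    by (auto simp: q_def in_keys_iff lookup_minus lookup_single when_def split: if_splits)
  with Suc(2) x have "n = card (Poly_Mapping.keys q)" by simp
  then have "P q" by (rule Suc(1))
  then have "P (q + Poly_Mapping.single x (Poly_Mapping.lookup p x))"
    using assms by blast
  then show ?case by (simp add: q_def)
qed

lemma scaleC_single: "c *\<^sub>C Poly_Mapping.single x d = Poly_Mapping.single x (c * d :: complex)"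
  by (rule poly_mapping_eqI)
     (auto simp: scaleC_poly_mapping.rep_eq lookup_single when_def scaleC_complex_def)

lemma tensor_induct [case_names elem add]:
  assumes "\<And>a b. P (a \<otimes> b)" and "\<And>s t. P s \<Longrightarrow> P t \<Longrightarrow> P (s + t)"
  shows "P t"
proof -
  have "P (abs_tensor p)" for p
  proof (induction p rule: free_vector_induct)
    case (1 x c)
    have "abs_tensor (Poly_Mapping.single x c) = (c *\<^sub>C fst x) \<otimes> snd x"
      unfolding elem_tensor_scaleC_left
      by (simp add: elem_tensor.abs_eq scaleC_tensor.abs_eq scaleC_single)
    then show ?case using assms(1) by simp
  next
    case (2 p q)
    then show ?case using assms(2) by (simp add: plus_tensor.abs_eq[symmetric])
  qed
  then show ?thesis by (metis Quotient_abs_rep[OF Quotient_tensor])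
qed


subsection \<open>Universal property\<close>

definition balanced :: "('a::complex_vector \<Rightarrow> 'b::complex_vector \<Rightarrow> 'c::ab_group_add) \<Rightarrow> bool"
  where "balanced f \<longleftrightarrow> (\<forall>a a' b. f (a + a') b = f a b + f a' b)
    \<and> (\<forall>a b b'. f a (b + b') = f a b + f a b') \<and> (\<forall>c a b. f (c *\<^sub>C a) b = f a (c *\<^sub>C b))"

text \<open>The map on \<open>V \<otimes> W\<close> induced by \<open>f\<close>. Only additivity is required, so that this applies both to
  bilinear maps and to maps that are antilinear in both arguments, such as the involution. The
  description determines the map if \<open>f\<close> is balanced, and only then has a meaning.\<close>

definition tensor_lift ::
    "('a::complex_vector \<Rightarrow> 'b::complex_vector \<Rightarrow> 'c::ab_group_add) \<Rightarrow> ('a, 'b) tensor \<Rightarrow> 'c"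
  where "tensor_lift f = (THE g. (\<forall>s t. g (s + t) = g s + g t) \<and> (\<forall>a b. g (a \<otimes> b) = f a b))"

lemma tensor_lift_ex:
  fixes f :: "'a::complex_vector \<Rightarrow> 'b::complex_vector \<Rightarrow> 'c::ab_group_add"
  assumes "balanced f"
  shows "\<exists>g. (\<forall>s t. g (s + t) = g s + g t) \<and> (\<forall>a b. g (a \<otimes> b) = f a b)"
proof -
  have addl: "f (a + a') b = f a b + f a' b" and addr: "f a (b + b') = f a b + f a b'"
    and bal: "f (c *\<^sub>C a) b = f a (c *\<^sub>C b)" for a a' b b' c
    using assms by (auto simp: balanced_def)
  have zero: "f 0 b = 0" for b using addl[of 0 0 b] by simp
  have neg: "f (- a) b = - f a b" for a b
    using addl[of a "- a" b] by (simp add: zero eq_neg_iff_add_eq_0 add.commute)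
  define F where "F p = (\<Sum>x\<in>Poly_Mapping.keys p. f (Poly_Mapping.lookup p x *\<^sub>C fst x) (snd x))"
    for p :: "'a \<times> 'b \<Rightarrow>\<^sub>0 complex"
  have F_eq: "F p = (\<Sum>x\<in>S. f (Poly_Mapping.lookup p x *\<^sub>C fst x) (snd x))"
    if "finite S" "Poly_Mapping.keys p \<subseteq> S" for p S
    unfolding F_def using that
    by (intro sum.mono_neutral_left) (auto simp: in_keys_iff zero)
  have F_add: "F (p + q) = F p + F q" for p q
  proof -
    let ?S = "Poly_Mapping.keys p \<union> Poly_Mapping.keys q"
    have "F (p + q) = (\<Sum>x\<in>?S. f (Poly_Mapping.lookup (p + q) x *\<^sub>C fst x) (snd x))"
      by (rule F_eq) (auto simp: Poly_Mapping.keys_add)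
    also have "\<dots> = F p + F q"
      by (simp add: F_eq[of ?S p] F_eq[of ?S q] lookup_add scaleC_add_left addl sum.distrib)
    finally show ?thesis .
  qed
  have F_zero: "F 0 = 0" by (simp add: F_def)
  have F_neg: "F (- p) = - F p" for p
    using F_add[of p "- p"] by (simp add: F_zero eq_neg_iff_add_eq_0 add.commute)
  have F_diff: "F (p - q) = F p - F q" for p q
    using F_add[of p "- q"] by (simp add: F_neg)
  have F_single: "F (Poly_Mapping.single (a, b) c) = f (c *\<^sub>C a) b" for a b c
    by (cases "c = 0") (auto simp: F_def zero)
  have null: "\<forall>c. F (c *\<^sub>C p) = 0" if "p \<in> complex_vector.span tensor_relations" for p
    using that
  proof (induction p rule: complex_vector.span_induct)
    case base
    show ?case
      by (auto simp: complex_vector.subspace_def scaleC_add_right F_add F_zero)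
  next
    case (step p)
    then show ?case
    proof cases
      case (scale_right a k b)
      have "(c * k) *\<^sub>C a = k *\<^sub>C c *\<^sub>C a" for c by (simp add: mult.commute)
      then show ?thesis unfolding scale_right
        by (simp only: complex_vector.scale_right_diff_distrib scaleC_single F_diff F_single bal
            mult_1_right diff_self simp_thms)
    qed (simp_all add: complex_vector.scale_right_diff_distrib scaleC_single
          F_diff F_add F_single scaleC_add_right addl addr)
  qed
  have resp: "F p = F q" if "tensor_rel p q" for p q
    using null[of "p - q"] that F_diff[of p q] by (auto simp: tensor_rel_def dest: spec[of _ 1])
  define g where "g t = F (rep_tensor t)" for t
  have g_abs: "g (abs_tensor p) = F p" for p
    unfolding g_def
    by (rule resp, rule Quotient_rep_abs[OF Quotient_tensor])
       (simp add: tensor_rel_def complex_vector.span_zero)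
  have "g (s + t) = g s + g t" for s t
    by (metis F_add Quotient_abs_rep[OF Quotient_tensor] g_abs plus_tensor.abs_eq)
  moreover have "g (a \<otimes> b) = f a b" for a b
    by (simp add: elem_tensor.abs_eq g_abs F_single)
  ultimately show ?thesis by blast
qed

lemma tensor_map_eqI:
  assumes "\<And>s t. g (s + t) = g s + g t" "\<And>s t. h (s + t) = h s + h t"
    and "\<And>a b. g (a \<otimes> b) = h (a \<otimes> b)"
  shows "g t = h t"
  by (induction t rule: tensor_induct) (simp_all add: assms)

lemma tensor_lift_works:
  fixes f :: "'a::complex_vector \<Rightarrow> 'b::complex_vector \<Rightarrow> 'c::ab_group_add"
  assumes "balanced f"
  shows "(\<forall>s t. tensor_lift f (s + t) = tensor_lift f s + tensor_lift f t)
    \<and> (\<forall>a b. tensor_lift f (a \<otimes> b) = f a b)"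
proof -
  let ?P = "\<lambda>g :: ('a, 'b) tensor \<Rightarrow> 'c. (\<forall>s t. g (s + t) = g s + g t) \<and> (\<forall>a b. g (a \<otimes> b) = f a b)"
  obtain g where g: "?P g" using tensor_lift_ex[OF assms] by blast
  have "h = g" if "?P h" for h
  proof
    show "h t = g t" for t
      using g that by (intro tensor_map_eqI[of h g t]) auto
  qed
  with g have "?P (THE g. ?P g)" by (rule theI)
  then show ?thesis unfolding tensor_lift_def .
qed

lemma tensor_lift_add: "balanced f \<Longrightarrow> tensor_lift f (s + t) = tensor_lift f s + tensor_lift f t"
  and tensor_lift_elem: "balanced f \<Longrightarrow> tensor_lift f (a \<otimes> b) = f a b"
  using tensor_lift_works by blast+

lemma tensor_lift_scaleC:
  fixes f :: "'a::complex_vector \<Rightarrow> 'b::complex_vector \<Rightarrow> 'c::complex_vector"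
  assumes "balanced f" and "\<And>c a b. f (c *\<^sub>C a) b = c *\<^sub>C f a b"
  shows "tensor_lift f (c *\<^sub>C t) = c *\<^sub>C tensor_lift f t"
  by (induction t rule: tensor_induct)
     (simp_all add: tensor_lift_add tensor_lift_elem assms scaleC_add_right
        elem_tensor_scaleC_left[symmetric])

subsection \<open>The tensor product of *-algebras\<close>

definition elem_mult :: "'a::star_algebra \<Rightarrow> 'b::star_algebra \<Rightarrow> ('a, 'b) tensor \<Rightarrow> ('a, 'b) tensor"
  where "elem_mult a b = tensor_lift (\<lambda>c d. (a * c) \<otimes> (b * d))"

lemma balanced_elem_mult_inner: "balanced (\<lambda>c d. (a * c) \<otimes> (b * d))"
  for a :: "'a::star_algebra" and b :: "'b::star_algebra"
  by (auto simp: balanced_def distrib_left elem_tensor_add_left elem_tensor_add_right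
      elem_tensor_scaleC_left elem_tensor_scaleC_right)

lemma elem_mult_elem: "elem_mult a b (c \<otimes> d) = (a * c) \<otimes> (b * d)"
  unfolding elem_mult_def by (rule tensor_lift_elem[OF balanced_elem_mult_inner])

lemma elem_mult_add: "elem_mult a b (s + t) = elem_mult a b s + elem_mult a b t"
  unfolding elem_mult_def by (rule tensor_lift_add[OF balanced_elem_mult_inner])

lemma balanced_elem_mult: "balanced (\<lambda>a b. elem_mult a b t)"
proof -
  have "elem_mult (a + a') b t = elem_mult a b t + elem_mult a' b t" for a a' b
    by (induction t rule: tensor_induct)
       (simp_all add: elem_mult_elem elem_mult_add distrib_right elem_tensor_add_left)
  moreover have "elem_mult a (b + b') t = elem_mult a b t + elem_mult a b' t" for a b b'
    by (induction t rule: tensor_induct)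
       (simp_all add: elem_mult_elem elem_mult_add distrib_right elem_tensor_add_right)
  moreover have "elem_mult (k *\<^sub>C a) b t = elem_mult a (k *\<^sub>C b) t" for a b k
    by (induction t rule: tensor_induct)
       (simp_all add: elem_mult_elem elem_mult_add elem_tensor_scaleC_left elem_tensor_scaleC_right)
  ultimately show ?thesis unfolding balanced_def by blast
qed

instantiation tensor :: (star_algebra, star_algebra) star_algebra
begin

definition one_tensor :: "('a, 'b) tensor"
  where "one_tensor = 1 \<otimes> 1"

definition times_tensor :: "('a, 'b) tensor \<Rightarrow> ('a, 'b) tensor \<Rightarrow> ('a, 'b) tensor"
  where "times_tensor s t = tensor_lift (\<lambda>a b. elem_mult a b t) s"

definition star_tensor :: "('a, 'b) tensor \<Rightarrow> ('a, 'b) tensor"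
  where "star_tensor = tensor_lift (\<lambda>a b. star a \<otimes> star b)"

lemma times_elem_left: "((a::'a) \<otimes> (b::'b)) * t = elem_mult a b t"
  unfolding times_tensor_def by (rule tensor_lift_elem[OF balanced_elem_mult])

lemma times_elem: "((a::'a) \<otimes> (b::'b)) * (c \<otimes> d) = (a * c) \<otimes> (b * d)"
  by (simp add: times_elem_left elem_mult_elem)

lemma times_add_left: "(s + s') * t = s * t + s' * (t :: ('a, 'b) tensor)"
  unfolding times_tensor_def by (rule tensor_lift_add[OF balanced_elem_mult])

lemma times_add_right: "t * (s + s') = t * s + t * (s' :: ('a, 'b) tensor)"
  by (induction t rule: tensor_induct)
     (simp_all add: times_elem_left elem_mult_add times_add_left add_ac)

lemma balanced_star: "balanced (\<lambda>a b. star (a::'a) \<otimes> star (b::'b))"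
  by (auto simp: balanced_def star_add star_scaleC elem_tensor_add_left elem_tensor_add_right
      elem_tensor_scaleC_left elem_tensor_scaleC_right)

lemma star_elem: "star ((a::'a) \<otimes> (b::'b)) = star a \<otimes> star b"
  by (simp add: star_tensor_def tensor_lift_elem balanced_star)

lemma star_add_tensor: "star (s + t) = star s + star (t :: ('a, 'b) tensor)"
  by (simp add: star_tensor_def tensor_lift_add balanced_star)

lemma scaleC_times_left: "(c *\<^sub>C s) * t = c *\<^sub>C (s * (t :: ('a, 'b) tensor))"
proof (induction s rule: tensor_induct)
  case (elem a b)
  show ?case
    by (induction t rule: tensor_induct)
       (simp_all add: elem_tensor_scaleC_left[symmetric] times_elem times_add_right scaleC_add_right)
qed (simp add: scaleC_add_right times_add_left)

lemma scaleC_times_right: "s * (c *\<^sub>C t) = c *\<^sub>C (s * (t :: ('a, 'b) tensor))"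
proof (induction s rule: tensor_induct)
  case (elem a b)
  show ?case
    by (induction t rule: tensor_induct)
       (simp_all add: elem_tensor_scaleC_left[symmetric] times_elem times_add_right scaleC_add_right)
qed (simp add: scaleC_add_right times_add_left)

lemma times_assoc_tensor: "(s * t) * u = s * (t * (u :: ('a, 'b) tensor))"
proof (induction s rule: tensor_induct)
  case (elem a b)
  show ?case
  proof (induction t rule: tensor_induct)
    case (elem c d)
    show ?case
      by (induction u rule: tensor_induct) (simp_all add: times_elem times_add_right mult.assoc)
  qed (simp add: times_add_left times_add_right)
qed (simp add: times_add_left)

lemma star_times_tensor: "star (s * t) = star t * star (s :: ('a, 'b) tensor)"
proof (induction s rule: tensor_induct)
  case (elem a b)
  show ?case
    by (induction t rule: tensor_induct)
       (simp_all add: times_elem times_add_left times_add_right star_add_tensor star_elem star_mult)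
qed (simp add: times_add_left times_add_right star_add_tensor)

lemma functional_exists: "\<exists>\<phi> :: 'c::complex_algebra_1 \<Rightarrow> complex. clinear \<phi> \<and> \<phi> 1 = 1"
proof -
  interpret vector_space_pair "scaleC :: complex \<Rightarrow> 'c \<Rightarrow> 'c" "scaleC :: complex \<Rightarrow> complex \<Rightarrow> complex"
    by unfold_locales
  have "complex_vector.independent {1 :: 'c}" by simp
  from linear_independent_extend[OF this, of "\<lambda>_. 1"] show ?thesis by auto
qed

lemma one_neq_zero_tensor: "(0 :: ('a, 'b) tensor) \<noteq> 1 \<otimes> 1"
proof
  assume *: "(0 :: ('a, 'b) tensor) = 1 \<otimes> 1"
  obtain \<phi> :: "'a \<Rightarrow> complex" and \<psi> :: "'b \<Rightarrow> complex"
    where \<phi>: "clinear \<phi>" "\<phi> 1 = 1" and \<psi>: "clinear \<psi>" "\<psi> 1 = 1"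
    using functional_exists by metis
  have bal: "balanced (\<lambda>a b. \<phi> a * \<psi> b)"
    using \<phi>(1) \<psi>(1) by (auto simp: balanced_def Vector_Spaces.linear_iff scaleC_complex_def algebra_simps)
  have "tensor_lift (\<lambda>a b. \<phi> a * \<psi> b) 0 = 0"
    using tensor_lift_add[OF bal, of 0 0] by simp
  moreover have "tensor_lift (\<lambda>a b. \<phi> a * \<psi> b) 0 = 1"
    unfolding * by (simp add: tensor_lift_elem[OF bal] \<phi> \<psi>)
  ultimately show False by simp
qed

instance
proof
  fix s t u :: "('a, 'b) tensor" and c :: complex
  show "s * t * u = s * (t * u)" by (rule times_assoc_tensor)
  show "(s + t) * u = s * u + t * u" by (rule times_add_left)
  show "s * (t + u) = s * t + s * u" by (rule times_add_right)
  show "1 * s = s" unfolding one_tensor_def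
    by (induction s rule: tensor_induct) (simp_all add: times_elem times_add_right)
  show "s * 1 = s" unfolding one_tensor_def
    by (induction s rule: tensor_induct) (simp_all add: times_elem times_add_left)
  show "(0 :: ('a, 'b) tensor) \<noteq> 1" unfolding one_tensor_def by (rule one_neq_zero_tensor)
  show "(c *\<^sub>C s) * t = c *\<^sub>C (s * t)" by (rule scaleC_times_left)
  show "s * (c *\<^sub>C t) = c *\<^sub>C (s * t)" by (rule scaleC_times_right)
  show "star (s * t) = star t * star s" by (rule star_times_tensor)
  show "star (s + t) = star s + star t" by (rule star_add_tensor)
  show "star (star s) = s"
    by (induction s rule: tensor_induct) (simp_all add: star_elem star_add_tensor)
  show "star (c *\<^sub>C s) = cnj c *\<^sub>C star s"
    by (induction s rule: tensor_induct)
       (simp_all add: elem_tensor_scaleC_left[symmetric] star_elem star_add_tensor star_scaleC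
         scaleC_add_right)
qed

end

definition tensor_map :: "('a::complex_vector \<Rightarrow> 'c::complex_vector) \<Rightarrow>
    ('b::complex_vector \<Rightarrow> 'd::complex_vector) \<Rightarrow> ('a, 'b) tensor \<Rightarrow> ('c, 'd) tensor"
  where "tensor_map f g = tensor_lift (\<lambda>a b. f a \<otimes> g b)"

lemma tensor_map_elem:
  assumes "clinear f" "clinear g"
  shows "tensor_map f g (a \<otimes> b) = f a \<otimes> g b"
  unfolding tensor_map_def using assms
  by (intro tensor_lift_elem) (auto simp: balanced_def Vector_Spaces.linear_iff
      elem_tensor_add_left elem_tensor_add_right elem_tensor_scaleC_left elem_tensor_scaleC_right)

definition append_tensor :: "'c::complex_vector \<Rightarrow> ('a::complex_vector, 'b::complex_vector) tensor
    \<Rightarrow> ('a, ('b, 'c) tensor) tensor"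
  where "append_tensor c = tensor_lift (\<lambda>a b. a \<otimes> (b \<otimes> c))"

definition tensor_assoc :: "(('a::complex_vector, 'b::complex_vector) tensor, 'c::complex_vector) tensor
    \<Rightarrow> ('a, ('b, 'c) tensor) tensor"
  where "tensor_assoc = tensor_lift (\<lambda>t c. append_tensor c t)"

lemma balanced_append_tensor: "balanced (\<lambda>a b. a \<otimes> (b \<otimes> c))"
  by (auto simp: balanced_def elem_tensor_add_left elem_tensor_add_right
      elem_tensor_scaleC_left elem_tensor_scaleC_right)

lemma append_tensor_elem: "append_tensor c (a \<otimes> b) = a \<otimes> (b \<otimes> c)"
  unfolding append_tensor_def by (rule tensor_lift_elem[OF balanced_append_tensor])

lemma append_tensor_add: "append_tensor c (s + t) = append_tensor c s + append_tensor c t"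
  unfolding append_tensor_def by (rule tensor_lift_add[OF balanced_append_tensor])

lemma append_tensor_scaleC: "append_tensor c (k *\<^sub>C t) = k *\<^sub>C append_tensor c t"
  unfolding append_tensor_def
  by (rule tensor_lift_scaleC[OF balanced_append_tensor elem_tensor_scaleC_left])

lemma balanced_tensor_assoc: "balanced (\<lambda>(t :: ('a::complex_vector, 'b::complex_vector) tensor) (c :: 'c::complex_vector).
    append_tensor c t)"
proof -
  have "append_tensor (c + c') t = append_tensor c t + append_tensor c' t"
    for c c' :: 'c and t :: "('a, 'b) tensor"
    by (induction t rule: tensor_induct)
       (simp_all add: append_tensor_elem append_tensor_add elem_tensor_add_right)
  moreover have "k *\<^sub>C append_tensor c t = append_tensor (k *\<^sub>C c) t"
    for c :: 'c and k and t :: "('a, 'b) tensor"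
    by (induction t rule: tensor_induct)
       (simp_all add: append_tensor_elem append_tensor_add scaleC_add_right elem_tensor_scaleC_right)
  ultimately show ?thesis
    by (simp add: balanced_def append_tensor_add append_tensor_scaleC)
qed

lemma tensor_assoc_elem: "tensor_assoc ((a \<otimes> b) \<otimes> c) = a \<otimes> (b \<otimes> c)"
  by (simp add: tensor_assoc_def tensor_lift_elem balanced_tensor_assoc append_tensor_elem)

text \<open>The maps \<open>\<phi> \<otimes> \<psi>\<close>, \<open>\<phi> \<otimes> id\<close> and \<open>id \<otimes> \<phi>\<close> for functionals \<open>\<phi>\<close>, \<open>\<psi>\<close>, with \<open>\<complex> \<otimes> V\<close> and \<open>V \<otimes> \<complex>\<close>
  identified with \<open>V\<close>.\<close>

definition functional_tensor :: "('a::complex_vector \<Rightarrow> complex) \<Rightarrow> ('b::complex_vector \<Rightarrow> complex)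
    \<Rightarrow> ('a, 'b) tensor \<Rightarrow> complex"
  where "functional_tensor \<phi> \<psi> = tensor_lift (\<lambda>a b. \<phi> a * \<psi> b)"

definition slice_left :: "('a::complex_vector \<Rightarrow> complex) \<Rightarrow> ('a, 'b::complex_vector) tensor \<Rightarrow> 'b"
  where "slice_left \<phi> = tensor_lift (\<lambda>a b. \<phi> a *\<^sub>C b)"

definition slice_right :: "('b::complex_vector \<Rightarrow> complex) \<Rightarrow> ('a::complex_vector, 'b) tensor \<Rightarrow> 'a"
  where "slice_right \<phi> = tensor_lift (\<lambda>a b. \<phi> b *\<^sub>C a)"

lemma functional_tensor_elem:
  "clinear \<phi> \<Longrightarrow> clinear \<psi> \<Longrightarrow> functional_tensor \<phi> \<psi> (a \<otimes> b) = \<phi> a * \<psi> b"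
  unfolding functional_tensor_def
  by (rule tensor_lift_elem)
     (auto simp: balanced_def Vector_Spaces.linear_iff scaleC_complex_def algebra_simps)

lemma slice_left_elem: "clinear \<phi> \<Longrightarrow> slice_left \<phi> (a \<otimes> b) = \<phi> a *\<^sub>C b"
  unfolding slice_left_def
  by (rule tensor_lift_elem) (auto simp: balanced_def Vector_Spaces.linear_iff
      scaleC_add_left scaleC_add_right scaleC_complex_def mult.commute)

lemma slice_right_elem: "clinear \<phi> \<Longrightarrow> slice_right \<phi> (a \<otimes> b) = \<phi> b *\<^sub>C a"
  unfolding slice_right_def
  by (rule tensor_lift_elem) (auto simp: balanced_def Vector_Spaces.linear_iff
      scaleC_add_left scaleC_add_right scaleC_complex_def mult.commute)


section \<open>Finite quantum groups\<close>

definition coassociative :: "('a::complex_vector \<Rightarrow> ('a, 'a) tensor) \<Rightarrow> bool"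
  where "coassociative \<Delta> \<longleftrightarrow>
    (\<forall>a. tensor_map id \<Delta> (\<Delta> a) = tensor_assoc (tensor_map \<Delta> id (\<Delta> a)))"

text \<open>For a finite-dimensional C*-algebra the minimal tensor product is the algebraic one, and
  a linear subspace of a finite-dimensional normed space is dense only if it is the whole space; the
  two density conditions are therefore equalities.\<close>

definition finite_quantum_group :: "('a::cstar_algebra \<Rightarrow> ('a, 'a) tensor) \<Rightarrow> bool"
  where "finite_quantum_group \<Delta> \<longleftrightarrow>
    (\<exists>B :: 'a set. finite B \<and> complex_vector.span B = UNIV)
    \<and> star_hom \<Delta> \<and> coassociative \<Delta>
    \<and> complex_vector.span {\<Delta> b * (1 \<otimes> a) | a b. True} = UNIV
    \<and> complex_vector.span {\<Delta> b * (a \<otimes> 1) | a b. True} = UNIV"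

definition character :: "('a::complex_algebra_1 \<Rightarrow> complex) \<Rightarrow> bool"
  where "character \<phi> \<longleftrightarrow> clinear \<phi> \<and> (\<forall>a b. \<phi> (a * b) = \<phi> a * \<phi> b) \<and> \<phi> \<noteq> (\<lambda>_. 0)"

definition counit :: "('a::cstar_algebra \<Rightarrow> ('a, 'a) tensor) \<Rightarrow> ('a \<Rightarrow> complex) \<Rightarrow> bool"
  where "counit \<Delta> \<epsilon> \<longleftrightarrow> character \<epsilon>
    \<and> (\<forall>a. slice_left \<epsilon> (\<Delta> a) = a) \<and> (\<forall>a. slice_right \<epsilon> (\<Delta> a) = a)"

definition state :: "('a::cstar_algebra \<Rightarrow> complex) \<Rightarrow> bool"
  where "state \<phi> \<longleftrightarrow> clinear \<phi> \<and> (\<forall>a. 0 \<le> \<phi> (star a * a)) \<and> \<phi> 1 = 1"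

definition haar_state :: "('a::cstar_algebra \<Rightarrow> ('a, 'a) tensor) \<Rightarrow> ('a \<Rightarrow> complex) \<Rightarrow> bool"
  where "haar_state \<Delta> h \<longleftrightarrow> state h
    \<and> (\<forall>a. slice_right h (\<Delta> a) = h a *\<^sub>C 1) \<and> (\<forall>a. slice_left h (\<Delta> a) = h a *\<^sub>C 1)"

text \<open>The Hilbert space \<open>L\<^sup>2(A, h)\<close> is \<open>A\<close> itself with this inner product, and the Hilbert space
  \<open>L\<^sup>2(A, h) \<otimes> L\<^sup>2(A, h)\<close> is accordingly \<open>A \<otimes> A\<close>.\<close>

definition gns_inner :: "('a::cstar_algebra \<Rightarrow> complex) \<Rightarrow> 'a \<Rightarrow> 'a \<Rightarrow> complex"
  where "gns_inner h u v = h (star u * v)"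

definition multiplicative_unitary ::
    "('a::cstar_algebra \<Rightarrow> ('a, 'a) tensor) \<Rightarrow> ('a, 'a) tensor \<Rightarrow> ('a, 'a) tensor"
  where "multiplicative_unitary \<Delta> = tensor_lift (\<lambda>a b. \<Delta> a * (1 \<otimes> b))"

lemma multiplicative_unitary_elem:
  assumes "clinear \<Delta>"
  shows "multiplicative_unitary \<Delta> (a \<otimes> b) = \<Delta> a * (1 \<otimes> b)"
  unfolding multiplicative_unitary_def using assms
  by (intro tensor_lift_elem) (auto simp: balanced_def Vector_Spaces.linear_iff
      distrib_left distrib_right elem_tensor_add_right elem_tensor_scaleC_right)

definition pre_subgroup :: "('a::cstar_algebra \<Rightarrow> ('a, 'a) tensor) \<Rightarrow> ('a \<Rightarrow> complex)
    \<Rightarrow> ('a \<Rightarrow> complex) \<Rightarrow> 'a \<Rightarrow> bool"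
  where "pre_subgroup \<Delta> h \<epsilon> f \<longleftrightarrow> gns_inner h f f = 1 \<and> 0 < \<epsilon> f
    \<and> multiplicative_unitary \<Delta> (f \<otimes> f) = f \<otimes> f"

definition pre_subgroup_le :: "('a::cstar_algebra \<Rightarrow> ('a, 'a) tensor) \<Rightarrow> 'a \<Rightarrow> 'a \<Rightarrow> bool"
  where "pre_subgroup_le \<Delta> g f \<longleftrightarrow> multiplicative_unitary \<Delta> (f \<otimes> g) = f \<otimes> g"

definition convolution :: "('a::cstar_algebra \<Rightarrow> ('a, 'a) tensor) \<Rightarrow> ('a \<Rightarrow> complex)
    \<Rightarrow> ('a \<Rightarrow> complex) \<Rightarrow> 'a \<Rightarrow> complex"
  where "convolution \<Delta> \<psi>\<^sub>1 \<psi>\<^sub>2 = functional_tensor \<psi>\<^sub>1 \<psi>\<^sub>2 \<circ> \<Delta>"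

definition idempotent_state :: "('a::cstar_algebra \<Rightarrow> ('a, 'a) tensor) \<Rightarrow> ('a \<Rightarrow> complex) \<Rightarrow> bool"
  where "idempotent_state \<Delta> \<phi> \<longleftrightarrow> state \<phi> \<and> convolution \<Delta> \<phi> \<phi> = \<phi>"

definition idempotent_state_le :: "('a::cstar_algebra \<Rightarrow> ('a, 'a) tensor) \<Rightarrow> ('a \<Rightarrow> complex)
    \<Rightarrow> ('a \<Rightarrow> complex) \<Rightarrow> bool"
  where "idempotent_state_le \<Delta> \<phi>\<^sub>1 \<phi>\<^sub>2 \<longleftrightarrow> convolution \<Delta> \<phi>\<^sub>1 \<phi>\<^sub>2 = \<phi>\<^sub>2"

definition vector_functional :: "('a::cstar_algebra \<Rightarrow> complex) \<Rightarrow> 'a \<Rightarrow> 'a \<Rightarrow> complex"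
  where "vector_functional h f a = gns_inner h f (a * f)"

end

theory Submission
  imports Defs
begin

text \<open>A state \<open>\<phi>\<close> gives a contraction \<open>T = (id \<otimes> \<phi>)\<Delta>\<close> of \<open>L\<^sup>2(A, h)\<close>, and equality in the
  Cauchy--Schwarz inequality shows that \<open>T a = a\<close> iff \<open>\<Delta>(a)(1 \<otimes> g) = a \<otimes> g\<close> when
  \<open>\<phi> = \<omega>\<^sub>g\<close>. If \<open>\<phi>\<close> is idempotent then \<open>T\<close> is an orthogonal projection fixing the density
  \<open>x\<close> of \<open>\<phi> = h(x\<^sup>* \<sqdot>)\<close>, from which \<open>\<phi> = \<omega>\<^sub>f\<close> with \<open>f = x / \<epsilon>(x)\<^sup>1\<^sup>/\<^sup>2\<close>. Pre-subgroups are
  self-adjoint, and slicing with \<open>\<epsilon>\<close> reduces \<open>V(f \<otimes> g) = f \<otimes> g\<close> to \<open>f g = \<epsilon>(f) g\<close>. The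
  latter condition does not see the flip of \<open>\<Delta>\<close>, which exchanges \<open>\<omega>\<^sub>f \<star> \<omega>\<^sub>g\<close> and
  \<open>\<omega>\<^sub>g \<star> \<omega>\<^sub>f\<close>.\<close>

section \<open>Linear maps on tensor products\<close>

lemma clinear_add: "clinear f \<Longrightarrow> f (x + y) = f x + f y"
  and clinear_scaleC: "clinear f \<Longrightarrow> f (c *\<^sub>C x) = c *\<^sub>C f x"
  by (simp_all add: Vector_Spaces.linear_iff)

lemma clinear_sum: "clinear f \<Longrightarrow> f (sum g S) = (\<Sum>x\<in>S. f (g x))"
  by (rule module_hom.sum[OF module_hom_linearI])

lemma clinear_diff: "clinear f \<Longrightarrow> f (x - y) = f x - f y"
  by (rule module_hom.diff[OF module_hom_linearI])

lemma clinear_zero: "clinear f \<Longrightarrow> f 0 = 0"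
  by (rule module_hom.zero[OF module_hom_linearI])

lemma clinearI:
  fixes f :: "'a::complex_vector \<Rightarrow> 'b::complex_vector"
  assumes "\<And>x y. f (x + y) = f x + f y" and "\<And>c x. f (c *\<^sub>C x) = c *\<^sub>C f x"
  shows "clinear f"
  using assms by (simp add: Vector_Spaces.linear_iff complex_vector.vector_space_axioms)

lemma clinear_complex_scaleC: "clinear \<phi> \<Longrightarrow> \<phi> (c *\<^sub>C x) = c * (\<phi> x :: complex)"
  by (simp add: clinear_scaleC scaleC_complex_def)

lemma tensor_clinear_eqI:
  assumes "clinear f" "clinear g" "\<And>a b. f (a \<otimes> b) = g (a \<otimes> b)"
  shows "f t = g t"
  using assms by (intro tensor_map_eqI[of f g t]) (auto simp: clinear_add)

lemma clinear_tensor_lift: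
  fixes f :: "'a::complex_vector \<Rightarrow> 'b::complex_vector \<Rightarrow> 'c::complex_vector"
  assumes "balanced f" and "\<And>c a b. f (c *\<^sub>C a) b = c *\<^sub>C f a b"
  shows "clinear (tensor_lift f)"
  by (intro clinearI tensor_lift_add[OF assms(1)] tensor_lift_scaleC[OF assms])

lemma clinear_slice_left: "clinear \<phi> \<Longrightarrow> clinear (slice_left \<phi>)"
  unfolding slice_left_def
  by (rule clinear_tensor_lift) (auto simp: balanced_def clinear_add clinear_complex_scaleC
      scaleC_add_left scaleC_add_right mult.commute)

lemma clinear_slice_right: "clinear \<phi> \<Longrightarrow> clinear (slice_right \<phi>)"
  unfolding slice_right_def
  by (rule clinear_tensor_lift) (auto simp: balanced_def clinear_add clinear_complex_scaleC
      scaleC_add_left scaleC_add_right mult.commute)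

lemma clinear_functional_tensor:
  "clinear \<phi> \<Longrightarrow> clinear \<psi> \<Longrightarrow> clinear (functional_tensor \<phi> \<psi>)"
  unfolding functional_tensor_def
  by (rule clinear_tensor_lift) (auto simp: balanced_def clinear_add clinear_complex_scaleC
      scaleC_complex_def algebra_simps)

lemma clinear_tensor_map:
  assumes "clinear f" "clinear g"
  shows "clinear (tensor_map f g)"
  unfolding tensor_map_def using assms
  by (intro clinear_tensor_lift) (auto simp: balanced_def clinear_add clinear_scaleC
      elem_tensor_add_left elem_tensor_add_right elem_tensor_scaleC_left elem_tensor_scaleC_right)

lemma clinear_append_tensor: "clinear (append_tensor c)"
  by (intro clinearI append_tensor_add append_tensor_scaleC)

lemma clinear_tensor_assoc: "clinear tensor_assoc"
  unfolding tensor_assoc_def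
  by (rule clinear_tensor_lift[OF balanced_tensor_assoc append_tensor_scaleC])

lemma tensor_assoc_elem_right: "tensor_assoc (s \<otimes> c) = append_tensor c s"
  by (simp add: tensor_assoc_def tensor_lift_elem balanced_tensor_assoc)

lemma clinear_compose: "clinear f \<Longrightarrow> clinear g \<Longrightarrow> clinear (\<lambda>x. g (f x))"
  by (intro clinearI) (simp_all add: clinear_add clinear_scaleC)

lemma clinear_mult_left: "clinear (\<lambda>x. a * x)" for a :: "'a::complex_algebra_1"
  by (intro clinearI) (simp_all add: distrib_left)

lemma clinear_mult_right: "clinear (\<lambda>x. x * a)" for a :: "'a::complex_algebra_1"
  by (intro clinearI) (simp_all add: distrib_right)

lemmas clinear_intros = clinear_slice_left clinear_slice_right clinear_functional_tensor
  clinear_tensor_map clinear_append_tensor clinear_tensor_assoc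
  clinear_mult_left clinear_mult_right

section \<open>Slices and their behaviour under products and the involution\<close>

text \<open>A Fubini principle: together with the left-handed version it evaluates one scalar by
  slicing the legs in either order.\<close>

lemma functional_tensor_slice_right:
  assumes "clinear \<phi>" "clinear \<psi>"
  shows "functional_tensor \<phi> \<psi> t = \<phi> (slice_right \<psi> t)"
  by (rule tensor_clinear_eqI[of "functional_tensor \<phi> \<psi>"])
     (use assms in \<open>simp_all add: clinear_intros clinear_compose[of "slice_right \<psi>" \<phi>]
        functional_tensor_elem slice_right_elem clinear_complex_scaleC\<close>)

lemma functional_tensor_slice_left:
  assumes "clinear \<phi>" "clinear \<psi>"
  shows "functional_tensor \<phi> \<psi> t = \<psi> (slice_left \<phi> t)"
  by (rule tensor_clinear_eqI[of "functional_tensor \<phi> \<psi>"])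
     (use assms in \<open>simp_all add: clinear_intros clinear_compose[of "slice_left \<phi>" \<psi>]
        functional_tensor_elem slice_left_elem clinear_complex_scaleC\<close>)

text \<open>Factors on the surviving leg come out, whereas factors on the sliced leg can only be
  absorbed into the functional. The three lemmas after it are mirror images.\<close>

lemma slice_right_mult_left:
  assumes "clinear \<phi>"
  shows "slice_right \<phi> ((a \<otimes> b) * t) = a * slice_right (\<lambda>y. \<phi> (b * y)) t"
proof -
  note l = clinear_compose[OF clinear_mult_left assms, of b]
  show ?thesis
    by (induction t rule: tensor_induct)
       (simp_all add: times_elem slice_right_elem l assms distrib_left
         clinear_add[OF clinear_slice_right])
qed

lemma slice_right_mult_right:
  assumes "clinear \<phi>"
  shows "slice_right \<phi> (t * (a \<otimes> b)) = slice_right (\<lambda>y. \<phi> (y * b)) t * a"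
proof -
  note l = clinear_compose[OF clinear_mult_right assms, of b]
  show ?thesis
    by (induction t rule: tensor_induct)
       (simp_all add: times_elem slice_right_elem l assms distrib_right
         clinear_add[OF clinear_slice_right])
qed

lemma slice_left_mult_left:
  assumes "clinear \<phi>"
  shows "slice_left \<phi> ((a \<otimes> b) * t) = b * slice_left (\<lambda>y. \<phi> (a * y)) t"
proof -
  note l = clinear_compose[OF clinear_mult_left assms, of a]
  show ?thesis
    by (induction t rule: tensor_induct)
       (simp_all add: times_elem slice_left_elem l assms distrib_left
         clinear_add[OF clinear_slice_left])
qed

lemma slice_left_mult_right:
  assumes "clinear \<phi>"
  shows "slice_left \<phi> (t * (a \<otimes> b)) = slice_left (\<lambda>y. \<phi> (y * a)) t * b"
proof -
  note l = clinear_compose[OF clinear_mult_right assms, of a]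
  show ?thesis
    by (induction t rule: tensor_induct)
       (simp_all add: times_elem slice_left_elem l assms distrib_right
         clinear_add[OF clinear_slice_left])
qed

lemma clinear_cnj_star: "clinear \<phi> \<Longrightarrow> clinear (\<lambda>y. cnj (\<phi> (star y)))" for \<phi> :: "'a::star_algebra \<Rightarrow> complex"
  by (intro clinearI) (simp_all add: star_add star_scaleC clinear_add clinear_complex_scaleC
      scaleC_complex_def)

text \<open>For a positive functional, \<open>cnj (\<phi> (star y))\<close> is
  \<open>\<phi> y\<close>, so slicing then commutes with \<open>star\<close>.\<close>

lemma slice_right_star:
  assumes "clinear \<phi>"
  shows "slice_right \<phi> (star t) = star (slice_right (\<lambda>y. cnj (\<phi> (star y))) t)"
proof -
  note l = clinear_cnj_star[OF assms]
  show ?thesis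
    by (induction t rule: tensor_induct)
       (simp_all add: star_elem slice_right_elem l assms star_scaleC star_add
         clinear_add[OF clinear_slice_right])
qed

text \<open>Applied to the counit in \<open>counit_star\<close>, at a point where its compatibility
  with \<open>star\<close> is still to be proved; hence the twisted functional in the
  statement.\<close>

lemma slice_left_star:
  assumes "clinear \<phi>"
  shows "slice_left \<phi> (star t) = star (slice_left (\<lambda>y. cnj (\<phi> (star y))) t)"
proof -
  note l = clinear_cnj_star[OF assms]
  show ?thesis
    by (induction t rule: tensor_induct)
       (simp_all add: star_elem slice_left_elem l assms star_scaleC star_add
         clinear_add[OF clinear_slice_left])
qed

section \<open>The flip of the two legs\<close>

text \<open>Composing \<open>\<Delta>\<close> with this map gives the opposite
  comultiplication.\<close>

definition flip :: "('a::complex_vector, 'b::complex_vector) tensor \<Rightarrow> ('b, 'a) tensor"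
  where "flip = tensor_lift (\<lambda>a b. b \<otimes> a)"

lemma balanced_flip: "balanced (\<lambda>a b. b \<otimes> a)"
  by (auto simp: balanced_def elem_tensor_add_left elem_tensor_add_right
      elem_tensor_scaleC_left elem_tensor_scaleC_right)

lemma flip_elem [simp]: "flip (a \<otimes> b) = b \<otimes> a"
  unfolding flip_def by (rule tensor_lift_elem[OF balanced_flip])

lemma clinear_flip: "clinear flip"
  unfolding flip_def by (rule clinear_tensor_lift[OF balanced_flip elem_tensor_scaleC_right])

lemma flip_flip [simp]: "flip (flip t) = t"
  by (induction t rule: tensor_induct) (simp_all add: clinear_add[OF clinear_flip])

lemma flip_mult: "flip (s * t) = flip s * flip t"
proof (induction s rule: tensor_induct)
  case (elem a b)
  show ?case
    by (induction t rule: tensor_induct)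
       (simp_all add: times_elem distrib_left clinear_add[OF clinear_flip])
qed (simp add: distrib_right clinear_add[OF clinear_flip])

lemma flip_star: "flip (star t) = star (flip t)"
  by (induction t rule: tensor_induct)
     (simp_all add: star_elem star_add clinear_add[OF clinear_flip])

lemma star_hom_flip: "star_hom f \<Longrightarrow> star_hom (flip \<circ> f)"
  using clinear_compose[OF _ clinear_flip, of f]
  by (simp add: star_hom_def flip_mult flip_star one_tensor_def o_def)

lemma slice_right_flip: "clinear \<phi> \<Longrightarrow> slice_right \<phi> (flip t) = slice_left \<phi> t"
  by (induction t rule: tensor_induct)
     (simp_all add: slice_left_elem slice_right_elem clinear_add clinear_slice_left clinear_slice_right
       clinear_flip)

lemma slice_left_flip: "clinear \<phi> \<Longrightarrow> slice_left \<phi> (flip t) = slice_right \<phi> t"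
  using slice_right_flip[of \<phi> "flip t"] by simp

lemma functional_tensor_flip:
  "clinear \<phi> \<Longrightarrow> clinear \<psi> \<Longrightarrow> functional_tensor \<phi> \<psi> (flip t) = functional_tensor \<psi> \<phi> t"
  by (simp only: functional_tensor_slice_right[of \<phi>] slice_right_flip
      functional_tensor_slice_left[of \<psi>])

section \<open>Expansions of tensors in finite dimension\<close>

text \<open>Expand the right leg in \<open>C\<close> and move the scalar coefficients into the left
  leg. A spanning \<open>C\<close> suffices, so orthogonal sets containing null vectors can be
  used.\<close>

lemma tensor_decompose_right:
  fixes t :: "('a::complex_vector, 'b::complex_vector) tensor"
  assumes "finite C" "complex_vector.span C = UNIV"
  shows "\<exists>a. t = (\<Sum>c\<in>C. a c \<otimes> c)"
proof (induction t rule: tensor_induct)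
  case (elem a b)
  have "b \<in> complex_vector.span C" using assms(2) by simp
  then obtain u where "b = (\<Sum>c\<in>C. u c *\<^sub>C c)"
    unfolding complex_vector.span_finite[OF assms(1)] by auto
  moreover have "clinear (\<lambda>b :: 'b. a \<otimes> b)"
    by (intro clinearI elem_tensor_add_right elem_tensor_scaleC_right)
  ultimately have "a \<otimes> b = (\<Sum>c\<in>C. (u c *\<^sub>C a) \<otimes> c)"
    by (simp add: clinear_sum[of "\<lambda>b. a \<otimes> b" "\<lambda>c. u c *\<^sub>C c"] elem_tensor_scaleC_left elem_tensor_scaleC_right)
  then show ?case by (rule exI[of _ "\<lambda>c. u c *\<^sub>C a"])
next
  case (add s t)
  then obtain a a' where "s = (\<Sum>c\<in>C. a c \<otimes> c)" "t = (\<Sum>c\<in>C. a' c \<otimes> c)" by blast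
  then have "s + t = (\<Sum>c\<in>C. (a c + a' c) \<otimes> c)" by (simp add: elem_tensor_add_left sum.distrib)
  then show ?case by (rule exI[of _ "\<lambda>c. a c + a' c"])
qed

lemma tensor_decompose_left:
  fixes t :: "('a::complex_vector, 'b::complex_vector) tensor"
  assumes "finite C" "complex_vector.span C = UNIV"
  shows "\<exists>b. t = (\<Sum>c\<in>C. c \<otimes> b c)"
proof -
  obtain b where "flip t = (\<Sum>c\<in>C. b c \<otimes> c)" using tensor_decompose_right[OF assms] by blast
  then have "flip (flip t) = flip (\<Sum>c\<in>C. b c \<otimes> c)" by (rule arg_cong)
  then have "t = (\<Sum>c\<in>C. c \<otimes> b c)" by (simp add: clinear_sum[OF clinear_flip])
  then show ?thesis by blast
qed

lemma finite_spanning_tensor: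
  assumes "finite (C :: 'a::complex_vector set)" "complex_vector.span C = UNIV"
    and "finite (D :: 'b::complex_vector set)" "complex_vector.span D = UNIV"
  shows "complex_vector.span ((\<lambda>(c, d). c \<otimes> d) ` (C \<times> D)) = UNIV"
proof -
  have "t \<in> complex_vector.span ((\<lambda>(c, d). c \<otimes> d) ` (C \<times> D))" for t
  proof -
    obtain a where t: "t = (\<Sum>d\<in>D. a d \<otimes> d)" using tensor_decompose_right[OF assms(3,4)] by blast
    have "a d \<otimes> d \<in> complex_vector.span ((\<lambda>(c, d). c \<otimes> d) ` (C \<times> D))" if d: "d \<in> D" for d
    proof -
      have "a d \<in> complex_vector.span C" using assms(2) by simp
      then obtain u where "a d = (\<Sum>c\<in>C. u c *\<^sub>C c)"
        unfolding complex_vector.span_finite[OF assms(1)] by auto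
      moreover have "clinear (\<lambda>a :: 'a. a \<otimes> d)"
        by (intro clinearI elem_tensor_add_left elem_tensor_scaleC_left)
      ultimately have "a d \<otimes> d = (\<Sum>c\<in>C. u c *\<^sub>C (c \<otimes> d))"
        by (simp add: clinear_sum[of "\<lambda>a. a \<otimes> d" "\<lambda>c. u c *\<^sub>C c"] elem_tensor_scaleC_left)
      then show ?thesis
        using d by (simp, intro complex_vector.span_sum complex_vector.span_scale
            complex_vector.span_base) auto
    qed
    then show ?thesis unfolding t by (intro complex_vector.span_sum)
  qed
  then show ?thesis by blast
qed

lemma surjective_endomorphism_onto_invariant_subspace:
  fixes W :: "'v::complex_vector \<Rightarrow> 'v"
  assumes fin: "finite (C :: 'v set)" "complex_vector.span C = UNIV"
    and W: "clinear W" "surj W"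
    and K: "complex_vector.subspace K" "W ` K \<subseteq> K"
  shows "W ` K = K"
proof -
  obtain B :: "'v set" where B: "complex_vector.independent B" "complex_vector.span B = UNIV"
    by (metis complex_vector.maximal_independent_subset[of UNIV] top.extremum_uniqueI)
  have "finite B"
    using complex_vector.independent_span_bound[OF fin(1) B(1)] fin(2) by simp
  with B interpret V: finite_dimensional_vector_space "scaleC :: complex \<Rightarrow> 'v \<Rightarrow> 'v" B
    by unfold_locales auto
  interpret P: finite_dimensional_vector_space_pair
      "scaleC :: complex \<Rightarrow> 'v \<Rightarrow> 'v" B "scaleC :: complex \<Rightarrow> 'v \<Rightarrow> 'v" B
    by unfold_locales
  have inj: "inj W" using V.linear_surj_imp_inj[OF W] .
  have "complex_vector.dim (W ` K) = complex_vector.dim K"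
    by (rule P.dim_image_eq[OF W(1)]) (use inj in \<open>auto intro: inj_on_subset\<close>)
  moreover have "complex_vector.subspace (W ` K)"
    using W(1) K(1) by (rule P.linear_subspace_image)
  ultimately show ?thesis
    using K V.subspace_dim_equal by (metis order_refl)
qed

section \<open>Positive functionals\<close>

lemma star_one [simp]: "star (1 :: 'a::star_algebra) = 1"
  by (metis mult_1_right star_mult star_star)

lemma star_zero [simp]: "star (0 :: 'a::star_algebra) = 0"
  by (metis add_cancel_right_right star_add)

lemma star_diff: "star (x - y) = star x - star (y :: 'a::star_algebra)"
  by (metis add_diff_cancel_right' diff_add_cancel star_add)

lemma star_sum: "star (sum f S) = (\<Sum>x\<in>S. star (f x :: 'a::star_algebra))"
  by (induction S rule: infinite_finite_induct) (simp_all add: star_add)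

definition positive_functional :: "('a::star_algebra \<Rightarrow> complex) \<Rightarrow> bool"
  where "positive_functional F \<longleftrightarrow> clinear F \<and> (\<forall>a. 0 \<le> F (star a * a))"

lemma positive_functionalD:
  assumes "positive_functional F"
  shows "clinear F" "0 \<le> F (star a * a)"
  using assms by (simp_all add: positive_functional_def)

text \<open>Polarisation: \<open>F (star x * x)\<close> is real for \<open>x = a + b\<close> and
  \<open>x = a + \<i> *\<^sub>C b\<close>, which settles the imaginary and the real part
  respectively.\<close>

lemma positive_functional_sesq_cnj:
  assumes F: "positive_functional F"
  shows "F (star b * a) = cnj (F (star a * b))"
proof -
  note l = positive_functionalD(1)[OF F]
  have im: "Im (F (star x * x)) = 0" for x
    using positive_functionalD(2)[OF F, of x] by (simp add: less_eq_complex_def)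
  have "Im (F (star (a + b) * (a + b))) = 0" "Im (F (star (a + \<i> *\<^sub>C b) * (a + \<i> *\<^sub>C b))) = 0"
    by (rule im)+
  then have "Im (F (star a * b)) + Im (F (star b * a)) = 0"
    "Re (F (star a * b)) - Re (F (star b * a)) = 0"
    using im[of a] im[of b]
    by (simp_all add: star_add star_scaleC distrib_left distrib_right left_diff_distrib clinear_add[OF l]
        clinear_diff[OF l]
        clinear_complex_scaleC[OF l])
  then show ?thesis by (simp add: complex_eq_iff)
qed

lemma positive_functional_cnj_star:
  assumes "positive_functional F"
  shows "cnj (F (star a)) = F a"
  using positive_functional_sesq_cnj[OF assms, of 1 a] by simp

text \<open>The degenerate case of Cauchy--Schwarz: otherwise a small step from \<open>t\<close>
  along \<open>s\<close> would make \<open>F (star u * u)\<close> negative.\<close>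

lemma positive_functional_null:
  assumes F: "positive_functional F" and t: "F (star t * t) = 0"
  shows "F (star s * t) = 0"
proof (rule ccontr)
  note l = positive_functionalD(1)[OF F]
  define c where "c = F (star s * t)"
  assume "F (star s * t) \<noteq> 0"
  then have c: "cmod c > 0" by (simp add: c_def)
  define M where "M = Re (F (star s * s))"
  have M: "F (star s * s) = of_real M" "M \<ge> 0"
    using positive_functionalD(2)[OF F, of s] by (auto simp: M_def complex_eq_iff less_eq_complex_def)
  \<comment> \<open>The \<open>+ 1\<close> covers \<open>M = 0\<close> and ensures
    \<open>r * M < 1\<close>, so the linear term \<open>- 2 * r\<close> outweighs the quadratic term
    \<open>r\<^sup>2 * M\<close>.\<close>
  define r where "r = 1 / (M + 1)"
  have r: "r > 0" using M by (simp add: r_def)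
  define u where "u = t - (of_real r * c) *\<^sub>C s"
  have ts: "F (star t * s) = cnj c"
    using positive_functional_sesq_cnj[OF F, of t s] by (simp add: c_def)
  have "F (star u * u) = of_real (r\<^sup>2 * M) * (c * cnj c) - of_real (2 * r) * (c * cnj c)"
    by (simp add: u_def star_diff star_scaleC left_diff_distrib right_diff_distrib clinear_diff[OF l]
        clinear_complex_scaleC[OF l] t M ts c_def[symmetric] power2_eq_square)
  also have "\<dots> = of_real (r\<^sup>2 * M * (cmod c)\<^sup>2 - 2 * r * (cmod c)\<^sup>2)"
    by (simp add: complex_norm_square[symmetric])
  finally have "F (star u * u) = of_real (r\<^sup>2 * M * (cmod c)\<^sup>2 - 2 * r * (cmod c)\<^sup>2)" .
  moreover have "0 \<le> F (star u * u)" by (rule positive_functionalD(2)[OF F])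
  ultimately have "0 \<le> r\<^sup>2 * M * (cmod c)\<^sup>2 - 2 * r * (cmod c)\<^sup>2"
    by (metis Re_complex_of_real less_eq_complex_def zero_complex.sel(1))
  then have "0 \<le> (cmod c)\<^sup>2 * (r * (r * M - 2))"
    by (simp add: algebra_simps power2_eq_square)
  moreover have "r * M - 2 < 0" using M by (simp add: r_def field_simps)
  ultimately show False using c r
    by (metis mult_pos_neg not_le zero_less_power)
qed

lemma positive_functional_cmult_left:
  assumes "positive_functional F"
  shows "positive_functional (\<lambda>a. F (star c * (a * c)))"
  using assms positive_functionalD(2)[OF assms, of "_ * c"]
  by (auto simp: positive_functional_def star_mult mult.assoc
      intro!: clinear_compose[OF clinear_mult_right] clinear_compose[OF clinear_mult_left])

text \<open>Gram--Schmidt for a semi-inner product: the projection coefficients onto null vectors are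
  divisions by zero, hence vanish, and null vectors are orthogonal to everything.\<close>

lemma orthogonal_spanning_set:
  fixes F :: "'a::star_algebra \<Rightarrow> complex" and B :: "'a set"
  assumes F: "positive_functional F" and "finite B"
  shows "\<exists>C. finite C \<and> B \<subseteq> complex_vector.span C
    \<and> (\<forall>c\<in>C. \<forall>d\<in>C. c \<noteq> d \<longrightarrow> F (star c * d) = 0)"
  using \<open>finite B\<close>
proof induction
  case empty
  then show ?case by (intro exI[of _ "{}"]) auto
next
  case (insert b B)
  note l = positive_functionalD(1)[OF F]
  from insert.IH obtain C where IH: "finite C \<and> B \<subseteq> complex_vector.span C
    \<and> (\<forall>c\<in>C. \<forall>d\<in>C. c \<noteq> d \<longrightarrow> F (star c * d) = 0)" ..
  have C: "finite C" "B \<subseteq> complex_vector.span C"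
    "\<And>c d. c \<in> C \<Longrightarrow> d \<in> C \<Longrightarrow> c \<noteq> d \<Longrightarrow> F (star c * d) = 0"
    using IH by auto
  define k where "k c = F (star c * b) / F (star c * c)" for c
  define p where "p = (\<Sum>c\<in>C. k c *\<^sub>C c)"
  define e where "e = b - p"
  have orth: "F (star d * e) = 0" if d: "d \<in> C" for d
  proof -
    have "F (star d * p) = (\<Sum>c\<in>C. k c * F (star d * c))"
      by (simp add: p_def sum_distrib_left clinear_sum[OF l] clinear_complex_scaleC[OF l])
    also have "\<dots> = (\<Sum>c\<in>C. if c = d then k d * F (star d * d) else 0)"
      by (rule sum.cong) (use C(3) d in auto)
    also have "\<dots> = k d * F (star d * d)" using C(1) d by simp
    also have "\<dots> = F (star d * b)"
      using positive_functional_null[OF F, of d b] positive_functional_sesq_cnj[OF F, of d b]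
      by (auto simp: k_def)
    finally show ?thesis by (simp add: e_def right_diff_distrib clinear_diff[OF l])
  qed
  then have orth': "F (star e * d) = 0" if "d \<in> C" for d
    using that positive_functional_sesq_cnj[OF F, of e d] by simp
  have sub: "complex_vector.span C \<subseteq> complex_vector.span (insert e C)"
    by (rule complex_vector.span_mono) auto
  have "p \<in> complex_vector.span C" unfolding p_def
    by (intro complex_vector.span_sum complex_vector.span_scale complex_vector.span_base)
  then have "e + p \<in> complex_vector.span (insert e C)"
    using sub by (intro complex_vector.span_add) (auto intro: complex_vector.span_base)
  then have "insert b B \<subseteq> complex_vector.span (insert e C)"
    using C(2) sub by (auto simp: e_def)
  then show ?case
    using C orth orth' by (intro exI[of _ "insert e C"]) auto
qed

text \<open>\<open>C\<close> spans and is orthogonal, but need not be independent: it may contain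
  null vectors of \<open>F\<close>, including 0.\<close>

lemma finite_orthogonal_basis:
  fixes F :: "'a::star_algebra \<Rightarrow> complex" and B :: "'a set"
  assumes F: "positive_functional F" and "finite B" "complex_vector.span B = UNIV"
  obtains C where "finite C" "complex_vector.span C = UNIV"
    "\<And>c d. c \<in> C \<Longrightarrow> d \<in> C \<Longrightarrow> c \<noteq> d \<Longrightarrow> F (star c * d) = 0"
proof -
  obtain C where C: "finite C \<and> B \<subseteq> complex_vector.span C
    \<and> (\<forall>c\<in>C. \<forall>d\<in>C. c \<noteq> d \<longrightarrow> F (star c * d) = 0)"
    using orthogonal_spanning_set[OF F assms(2)] ..
  have "complex_vector.span B \<subseteq> complex_vector.span C"
    by (rule complex_vector.span_minimal) (use C in auto)
  then show ?thesis using C assms(3) that[of C] by auto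
qed

section \<open>Positivity, faithfulness and representation of functionals\<close>

text \<open>Orthogonality of the right legs kills the cross terms. What remains is a sum of products
  of values at squares, from which positivity and faithfulness can be read off.\<close>

lemma functional_tensor_orthogonal:
  fixes \<phi> :: "'a::star_algebra \<Rightarrow> complex" and \<psi> :: "'b::star_algebra \<Rightarrow> complex"
  assumes l: "clinear \<phi>" "clinear \<psi>" and C: "finite C"
    "\<And>c d. c \<in> C \<Longrightarrow> d \<in> C \<Longrightarrow> c \<noteq> d \<Longrightarrow> \<psi> (star c * d) = 0"
    and t: "t = (\<Sum>c\<in>C. a c \<otimes> c)"
  shows "functional_tensor \<phi> \<psi> (star t * t) = (\<Sum>c\<in>C. \<phi> (star (a c) * a c) * \<psi> (star c * c))"
proof -
  have "star t * t = (\<Sum>c\<in>C. \<Sum>d\<in>C. (star (a c) * a d) \<otimes> (star c * d))"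
    unfolding t by (simp add: star_sum star_elem sum_distrib_left sum_distrib_right times_elem)
      (rule sum.swap)
  then have "functional_tensor \<phi> \<psi> (star t * t)
      = (\<Sum>c\<in>C. \<Sum>d\<in>C. \<phi> (star (a c) * a d) * \<psi> (star c * d))"
    by (simp add: clinear_sum[OF clinear_functional_tensor[OF l]] functional_tensor_elem l)
  also have "\<dots> = (\<Sum>c\<in>C. \<Sum>d\<in>C. if d = c then \<phi> (star (a c) * a c) * \<psi> (star c * c) else 0)"
    by (intro sum.cong refl) (use C(2) in auto)
  finally show ?thesis using C(1) by simp
qed

lemma positive_functional_tensor:
  fixes \<phi> :: "'a::star_algebra \<Rightarrow> complex" and \<psi> :: "'b::star_algebra \<Rightarrow> complex"
  assumes \<phi>: "positive_functional \<phi>" and \<psi>: "positive_functional \<psi>"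
    and fin: "finite (B :: 'b set)" "complex_vector.span B = UNIV"
  shows "positive_functional (functional_tensor \<phi> \<psi>)"
proof -
  note l = positive_functionalD(1)[OF \<phi>] positive_functionalD(1)[OF \<psi>]
  obtain C where C: "finite C" "complex_vector.span C = UNIV"
    "\<And>c d. c \<in> C \<Longrightarrow> d \<in> C \<Longrightarrow> c \<noteq> d \<Longrightarrow> \<psi> (star c * d) = 0"
    using finite_orthogonal_basis[OF \<psi> fin] by blast
  have "0 \<le> functional_tensor \<phi> \<psi> (star t * t)" for t
  proof -
    obtain a where t: "t = (\<Sum>c\<in>C. a c \<otimes> c)" using tensor_decompose_right[OF C(1,2)] by blast
    have "functional_tensor \<phi> \<psi> (star t * t) = (\<Sum>c\<in>C. \<phi> (star (a c) * a c) * \<psi> (star c * c))"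
      by (rule functional_tensor_orthogonal[OF l C(1) _ t]) (rule C(3))
    then show ?thesis
      by (simp only:) (intro sum_nonneg mult_nonneg_nonneg positive_functionalD(2) \<phi> \<psi>)
  qed
  then show ?thesis by (simp add: positive_functional_def clinear_functional_tensor l)
qed

text \<open>A vanishing sum of nonnegative terms vanishes termwise, so in each
  \<open>a c \<otimes> c\<close> one of the two legs is zero.\<close>

lemma functional_tensor_faithful:
  fixes \<phi> :: "'a::star_algebra \<Rightarrow> complex" and \<psi> :: "'b::star_algebra \<Rightarrow> complex"
  assumes \<phi>: "positive_functional \<phi>" "\<And>a. \<phi> (star a * a) = 0 \<Longrightarrow> a = 0"
    and \<psi>: "positive_functional \<psi>" "\<And>b. \<psi> (star b * b) = 0 \<Longrightarrow> b = 0"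
    and fin: "finite (B :: 'b set)" "complex_vector.span B = UNIV"
    and null: "functional_tensor \<phi> \<psi> (star t * t) = 0"
  shows "t = 0"
proof -
  note l = positive_functionalD(1)[OF \<phi>(1)] positive_functionalD(1)[OF \<psi>(1)]
  obtain C where C: "finite C" "complex_vector.span C = UNIV"
    "\<And>c d. c \<in> C \<Longrightarrow> d \<in> C \<Longrightarrow> c \<noteq> d \<Longrightarrow> \<psi> (star c * d) = 0"
    using finite_orthogonal_basis[OF \<psi>(1) fin] by blast
  obtain a where t: "t = (\<Sum>c\<in>C. a c \<otimes> c)" using tensor_decompose_right[OF C(1,2)] by blast
  have nn: "0 \<le> \<phi> (star (a c) * a c) * \<psi> (star c * c)" for c
    by (intro mult_nonneg_nonneg positive_functionalD(2) \<phi> \<psi>)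
  have "functional_tensor \<phi> \<psi> (star t * t) = (\<Sum>c\<in>C. \<phi> (star (a c) * a c) * \<psi> (star c * c))"
    by (rule functional_tensor_orthogonal[OF l C(1) _ t]) (rule C(3))
  then have "\<forall>c\<in>C. \<phi> (star (a c) * a c) * \<psi> (star c * c) = 0"
    using null nn C(1) by (simp add: sum_nonneg_eq_0_iff)
  then have "\<forall>c\<in>C. a c \<otimes> c = 0"
    using \<phi>(2) \<psi>(2) by (metis elem_tensor_zero_left elem_tensor_zero_right mult_eq_0_iff)
  then show ?thesis by (simp add: t)
qed

text \<open>The Riesz representation in finite dimension, with \<open>x\<close> given by its Fourier
  coefficients along an orthogonal spanning set.\<close>

lemma faithful_functional_representation:
  fixes F :: "'a::star_algebra \<Rightarrow> complex" and B :: "'a set"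
  assumes F: "positive_functional F" "\<And>a. F (star a * a) = 0 \<Longrightarrow> a = 0"
    and fin: "finite B" "complex_vector.span B = UNIV"
    and \<phi>: "clinear \<phi>"
  shows "\<exists>x. \<forall>a. \<phi> a = F (star x * a)"
proof -
  note l = positive_functionalD(1)[OF F(1)]
  obtain C where C: "finite C" "complex_vector.span C = UNIV"
    "\<And>c d. c \<in> C \<Longrightarrow> d \<in> C \<Longrightarrow> c \<noteq> d \<Longrightarrow> F (star c * d) = 0"
    using finite_orthogonal_basis[OF F(1) fin] by blast
  define x where "x = (\<Sum>c\<in>C. cnj (\<phi> c / F (star c * c)) *\<^sub>C c)"
  have "\<phi> a = F (star x * a)" for a
  proof -
    have "a \<in> complex_vector.span C" using C(2) by simp
    then obtain u where a: "a = (\<Sum>c\<in>C. u c *\<^sub>C c)"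
      unfolding complex_vector.span_finite[OF C(1)] by auto
    have "F (star x * a) = (\<Sum>c\<in>C. \<Sum>d\<in>C. \<phi> c / F (star c * c) * u d * F (star c * d))"
      by (simp add: x_def a star_sum star_scaleC sum_distrib_left sum_distrib_right clinear_sum[OF l]
          clinear_complex_scaleC[OF l] mult_ac) (rule sum.swap)
    \<comment> \<open>By faithfulness a zero denominator forces \<open>c = 0\<close>; then both
      sides are 0, because \<open>\<phi> 0 = 0\<close>.\<close>
    also have "\<dots> = (\<Sum>c\<in>C. \<Sum>d\<in>C. if d = c then u c * \<phi> c else 0)"
    proof (intro sum.cong refl)
      fix c d assume "c \<in> C" "d \<in> C"
      then show "\<phi> c / F (star c * c) * u d * F (star c * d) = (if d = c then u c * \<phi> c else 0)"
        using C(3)[of c d] F(2)[of c] clinear_zero[OF \<phi>] by (cases "d = c"; cases "c = 0") auto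
    qed
    also have "\<dots> = \<phi> a"
      using C(1) by (simp add: a clinear_sum[OF \<phi>] clinear_complex_scaleC[OF \<phi>])
    finally show ?thesis by simp
  qed
  then show ?thesis by blast
qed

section \<open>Faithfulness of the Haar state\<close>

lemma star_homD:
  assumes "star_hom f"
  shows "clinear f" "f (x * y) = f x * f y" "f 1 = 1" "f (star x) = star (f x)"
  using assms by (simp_all add: star_hom_def)

lemma state_positive_functional: "state \<phi> \<Longrightarrow> positive_functional \<phi>"
  and state_one: "state \<phi> \<Longrightarrow> \<phi> 1 = 1"
  by (simp_all add: state_def positive_functional_def)

lemma span_star_UNIV:
  fixes S :: "'a::star_algebra set"
  assumes "complex_vector.span S = UNIV"
  shows "complex_vector.span (star ` S) = UNIV"
proof -
  have "star x \<in> complex_vector.span (star ` S)" if "x \<in> complex_vector.span S" for x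
    using that
  proof (induction x rule: complex_vector.span_induct)
    case base
    then show ?case
      by (auto simp: complex_vector.subspace_def star_add star_scaleC
          intro: complex_vector.span_zero complex_vector.span_add complex_vector.span_scale)
  next
    case (step x)
    then show ?case by (auto intro: complex_vector.span_base)
  qed
  then have "star (star x) \<in> complex_vector.span (star ` S)" for x
    using assms by blast
  then show ?thesis by auto
qed

text \<open>The involution turns \<open>\<Delta> b * (a \<otimes> 1)\<close> into
  \<open>(star a \<otimes> 1) * \<Delta> (star b)\<close>, so this follows from the second density
  condition.\<close>

lemma finite_quantum_group_left_cancellation:
  assumes "finite_quantum_group \<Delta>"
  shows "complex_vector.span {(a \<otimes> 1) * \<Delta> b | a b. True} = UNIV"
proof -
  have hom: "star_hom \<Delta>"
    and dens: "complex_vector.span {\<Delta> b * (a \<otimes> 1) | a b. True} = UNIV"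
    using assms by (simp_all add: finite_quantum_group_def)
  have "star ` {\<Delta> b * (a \<otimes> 1) | a b. True} \<subseteq> {(a \<otimes> 1) * \<Delta> b | a b. True}"
    by (auto simp: star_mult star_elem star_homD(4)[OF hom, symmetric]) blast
  then have "complex_vector.span (star ` {\<Delta> b * (a \<otimes> 1) | a b. True})
      \<subseteq> complex_vector.span {(a \<otimes> 1) * \<Delta> b | a b. True}"
    by (rule complex_vector.span_mono)
  then show ?thesis unfolding span_star_UNIV[OF dens] by blast
qed

text \<open>By cancellation \<open>1 \<otimes> d\<close> is a combination of terms
  \<open>(a \<otimes> 1) * \<Delta> b\<close>, and for these invariance of \<open>h\<close> gives
  \<open>a * h (b * n)\<close>, which is 0. This is what places \<open>\<Delta> n\<close> in A
  \<otimes> N for the null ideal N.\<close>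

lemma haar_state_null_ideal:
  assumes fqg: "finite_quantum_group \<Delta>" and haar: "haar_state \<Delta> h"
    and null: "\<And>d. h (d * n) = 0"
  shows "slice_right h ((1 \<otimes> d) * \<Delta> n) = 0"
proof -
  have hom: "star_hom \<Delta>" using fqg by (simp add: finite_quantum_group_def)
  have h: "clinear h" and inv: "\<And>a. slice_right h (\<Delta> a) = h a *\<^sub>C 1"
    using haar by (simp_all add: haar_state_def state_def)
  have lin: "clinear (\<lambda>t. slice_right h (t * \<Delta> n))"
    by (intro clinear_compose[OF clinear_mult_right] clinear_slice_right h)
  have "slice_right h (t * \<Delta> n) = 0"
    if "t \<in> complex_vector.span {(a \<otimes> 1) * \<Delta> b | a b. True}" for t
    using that
  proof (induction t rule: complex_vector.span_induct)
    case base
    then show ?case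
      by (auto simp: complex_vector.subspace_def clinear_add[OF lin] clinear_scaleC[OF lin]
          clinear_zero[OF lin, simplified] simp del: mult_scaleC_left)
  next
    case (step t)
    then obtain a b where "t = (a \<otimes> 1) * \<Delta> b" by blast
    then have "slice_right h (t * \<Delta> n) = a * slice_right h (\<Delta> (b * n))"
      by (simp add: mult.assoc slice_right_mult_left[OF h] star_homD(2)[OF hom])
    then show ?case by (simp add: inv null)
  qed
  then show ?thesis using finite_quantum_group_left_cancellation[OF fqg] by blast
qed

text \<open>The null ideal \<open>N\<close> satisfies \<open>\<Delta>(N) \<subseteq> A \<otimes> N\<close>, so the bijection \<open>a \<otimes> b \<mapsto> (a \<otimes> 1)\<Delta>(b)\<close> of
  \<open>A \<otimes> A\<close> restricts, by finite dimension, to a bijection of \<open>A \<otimes> N\<close>. Applying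
  \<open>id \<otimes> \<epsilon>\<close> to \<open>1 \<otimes> n = \<Sum> (a\<^sub>i \<otimes> 1)\<Delta>(n\<^sub>i)\<close> gives \<open>\<epsilon>(n)1 = \<Sum> a\<^sub>i n\<^sub>i \<in> N\<close>, hence
  \<open>\<epsilon>(N) = 0\<close> because \<open>h(1) = 1\<close>.\<close>

lemma haar_state_nondegenerate:
  fixes \<Delta> :: "'a::cstar_algebra \<Rightarrow> ('a, 'a) tensor"
  assumes fqg: "finite_quantum_group \<Delta>" and eps: "counit \<Delta> \<epsilon>" and haar: "haar_state \<Delta> h"
    and null: "\<And>d. h (d * n) = 0"
  shows "n = 0"
proof -
  have hom: "star_hom \<Delta>" using fqg by (simp add: finite_quantum_group_def)
  note \<Delta> = star_homD(1)[OF hom]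
  have h: "clinear h" "h 1 = 1" using haar by (simp_all add: haar_state_def state_def)
  have \<epsilon>: "clinear \<epsilon>" "\<And>a. slice_right \<epsilon> (\<Delta> a) = a"
    using eps by (simp_all add: counit_def character_def)
  obtain B0 :: "'a set" where B0: "finite B0" "complex_vector.span B0 = UNIV"
    using fqg by (auto simp: finite_quantum_group_def)
  obtain B :: "'a set" where B: "complex_vector.independent B" "complex_vector.span B = UNIV"
    by (metis complex_vector.maximal_independent_subset[of UNIV] top.extremum_uniqueI)
  have finB: "finite B"
    using complex_vector.independent_span_bound[OF B0(1) B(1)] B0(2) by simp
  define N where "N = {n. \<forall>d. h (d * n) = 0}"
  define K where "K = complex_vector.span {a \<otimes> n | (a :: 'a) n. n \<in> N}"
  define W where "W = tensor_lift (\<lambda>a b. (a \<otimes> 1) * \<Delta> b)"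
  have bal: "balanced (\<lambda>a b. (a \<otimes> 1) * \<Delta> b)"
    by (auto simp: balanced_def distrib_left distrib_right elem_tensor_add_left
        elem_tensor_scaleC_left clinear_add[OF \<Delta>] clinear_scaleC[OF \<Delta>])
  have W: "clinear W" unfolding W_def
    by (rule clinear_tensor_lift[OF bal]) (simp add: elem_tensor_scaleC_left)
  have W_elem: "W (a \<otimes> b) = (a \<otimes> 1) * \<Delta> b" for a b
    unfolding W_def by (rule tensor_lift_elem[OF bal])
  have surj: "surj W"
  proof -
    have "{(a \<otimes> 1) * \<Delta> b | a b. True} \<subseteq> range W" by (auto simp: W_elem[symmetric])
    moreover have "complex_vector.subspace (range W)"
      using module_hom.subspace_image[OF module_hom_linearI[OF W]] complex_vector.subspace_UNIV by blast
    ultimately have "complex_vector.span {(a \<otimes> 1) * \<Delta> b | a b. True} \<subseteq> range W"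
      by (rule complex_vector.span_minimal)
    then show ?thesis unfolding finite_quantum_group_left_cancellation[OF fqg] by blast
  qed
  \<comment> \<open>With left legs from the independent set \<open>B\<close>, the slice is a
    combination of \<open>B\<close> with coefficients \<open>h (d * c b)\<close>; independence makes
    them all vanish, so every \<open>c b\<close> lies in \<open>N\<close>.\<close>
  have in_K: "t \<in> K" if t: "\<And>d. slice_right h ((1 \<otimes> d) * t) = 0" for t
  proof -
    obtain c where c: "t = (\<Sum>b\<in>B. b \<otimes> c b)" using tensor_decompose_left[OF finB B(2)] by blast
    have "c b \<in> N" if b: "b \<in> B" for b
    proof -
      have "h (d * c b) = 0" for d
      proof -
        have "(\<Sum>b\<in>B. h (d * c b) *\<^sub>C b) = 0"
          using t[of d] by (simp add: c sum_distrib_left times_elem slice_right_elem h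
              clinear_sum[OF clinear_slice_right[OF h(1)]])
        then show ?thesis
          using complex_vector.independentD[OF B(1) finB order_refl, of "\<lambda>b. h (d * c b)"] b by blast
      qed
      then show ?thesis by (simp add: N_def)
    qed
    then show ?thesis unfolding c K_def
      by (intro complex_vector.span_sum complex_vector.span_base) blast
  qed
  have inv: "W ` K \<subseteq> K"
  proof -
    have "W t \<in> K" if "t \<in> K" for t
      using that unfolding K_def
    proof (induction t rule: complex_vector.span_induct)
      case base
      then show ?case
        by (auto simp: complex_vector.subspace_def clinear_add[OF W] clinear_scaleC[OF W]
            clinear_zero[OF W]
            intro: complex_vector.span_zero complex_vector.span_add complex_vector.span_scale)
    next
      case (step t)
      then obtain a n where t: "t = a \<otimes> n" and n: "n \<in> N" by blast
      have "W t \<in> K"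
      proof (rule in_K)
        fix d
        have "(1 \<otimes> d) * ((a \<otimes> 1) * \<Delta> n) = (a \<otimes> 1) * ((1 \<otimes> d) * \<Delta> n)"
          by (simp add: mult.assoc[symmetric] times_elem)
        moreover have "slice_right h ((1 \<otimes> d) * \<Delta> n) = 0"
          using haar_state_null_ideal[OF fqg haar] n by (simp add: N_def)
        ultimately show "slice_right h ((1 \<otimes> d) * W t) = 0"
          by (simp add: t W_elem slice_right_mult_left[OF h(1), of a])
      qed
      then show ?case by (simp add: K_def)
    qed
    then show ?thesis by blast
  qed
  have onto: "W ` K = K"
    by (rule surjective_endomorphism_onto_invariant_subspace
        [OF _ finite_spanning_tensor[OF B0 B0] W surj _ inv])
      (use B0(1) in \<open>auto simp: K_def\<close>)
  have subN: "complex_vector.subspace N"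
    by (auto simp: complex_vector.subspace_def N_def distrib_left clinear_add[OF h(1)]
        clinear_complex_scaleC[OF h(1)] clinear_zero[OF h(1)])
  have slice_N: "slice_right \<epsilon> (W t) \<in> N" if "t \<in> K" for t
    using that unfolding K_def
  proof (induction t rule: complex_vector.span_induct)
    case base
    have "clinear (\<lambda>t. slice_right \<epsilon> (W t))"
      by (intro clinear_compose[OF W] clinear_slice_right \<epsilon>)
    from module_hom.subspace_vimage[OF module_hom_linearI[OF this] subN]
    show ?case by (simp add: vimage_def)
  next
    case (step t)
    then obtain a n where t: "t = a \<otimes> n" and n: "n \<in> N" by blast
    have "slice_right \<epsilon> (W t) = a * n"
      by (simp add: t W_elem slice_right_mult_left[OF \<epsilon>(1)] \<epsilon>)
    then show ?case using n by (simp add: N_def mult.assoc[symmetric])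
  qed
  have eps_N: "\<epsilon> m = 0" if m: "m \<in> N" for m
  proof -
    have "1 \<otimes> m \<in> K" unfolding K_def using m by (intro complex_vector.span_base) blast
    then obtain t where "t \<in> K" "1 \<otimes> m = W t" using onto by (metis imageE)
    with slice_N have "slice_right \<epsilon> (1 \<otimes> m) \<in> N" by simp
    then have "\<epsilon> m *\<^sub>C (1 :: 'a) \<in> N" by (simp add: slice_right_elem \<epsilon>)
    then have "h (1 * \<epsilon> m *\<^sub>C 1) = 0" unfolding N_def by blast
    then show ?thesis by (simp add: clinear_complex_scaleC[OF h(1)] h(2))
  qed
  have n: "n \<in> N" using null by (simp add: N_def)
  have "\<Delta> n \<in> K"
    by (rule in_K) (rule haar_state_null_ideal[OF fqg haar null])
  then have "slice_right \<epsilon> (\<Delta> n) = 0" unfolding K_def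
  proof (induction rule: complex_vector.span_induct)
    case base
    then show ?case
      using module_hom.subspace_kernel[OF module_hom_linearI[OF clinear_slice_right[OF \<epsilon>(1)]]] by simp
  next
    case (step t)
    then show ?case using eps_N by (auto simp: slice_right_elem \<epsilon>)
  qed
  then show ?thesis by (simp add: \<epsilon>)
qed

text \<open>By Cauchy--Schwarz a null vector of \<open>h\<close> lies in the left null ideal, which
  has just been shown to be trivial.\<close>

lemma haar_state_faithful:
  assumes "finite_quantum_group \<Delta>" "counit \<Delta> \<epsilon>" "haar_state \<Delta> h" and null: "h (star a * a) = 0"
  shows "a = 0"
proof (rule haar_state_nondegenerate[OF assms(1-3)])
  have "positive_functional h"
    using assms(3) by (simp add: haar_state_def state_positive_functional)
  from positive_functional_null[OF this null, of "star _"] show "h (d * a) = 0" for d by simp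
qed

section \<open>Convolution operators\<close>

text \<open>Evaluate \<open>\<phi>\<close> and \<open>\<psi>\<close> on the last two legs of both
  sides of coassociativity. Thus right slices compose as their functionals convolve, and an
  idempotent state gives an idempotent operator.\<close>

lemma slice_right_slice_right_coassociative:
  assumes hom: "star_hom (\<Delta> :: 'a::cstar_algebra \<Rightarrow> ('a, 'a) tensor)" and co: "coassociative \<Delta>" and l: "clinear \<phi>" "clinear \<psi>"
  shows "slice_right \<phi> (\<Delta> (slice_right \<psi> (\<Delta> a))) = slice_right (convolution \<Delta> \<phi> \<psi>) (\<Delta> a)"
proof -
  note \<Delta> = star_homD(1)[OF hom]
  have conv: "clinear (convolution \<Delta> \<phi> \<psi>)"
    unfolding convolution_def o_def by (intro clinear_compose[OF \<Delta>] clinear_functional_tensor l)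
  let ?P = "slice_right (functional_tensor \<phi> \<psi>)"
  have P: "clinear ?P" by (intro clinear_slice_right clinear_functional_tensor l)
  define I where "I = (id :: 'a \<Rightarrow> 'a)"
  have I: "clinear I" by (intro clinearI) (auto simp: I_def)
  have map_right: "tensor_map I \<Delta> (a \<otimes> b) = a \<otimes> \<Delta> b" for a b
    using tensor_map_elem[OF I \<Delta>, of a b] by (simp add: I_def)
  have map_left: "tensor_map \<Delta> I (a \<otimes> b) = \<Delta> a \<otimes> b" for a b
    using tensor_map_elem[OF \<Delta> I, of a b] by (simp add: I_def)
  have app: "?P (append_tensor b s) = \<psi> b *\<^sub>C slice_right \<phi> s" for b and s :: "('a, 'a) tensor"
    by (induction s rule: tensor_induct)
       (simp_all add: append_tensor_elem append_tensor_add clinear_add[OF P] l slice_right_elem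
        clinear_functional_tensor functional_tensor_elem mult.commute
        clinear_add[OF clinear_slice_right] scaleC_add_right)
  have "?P (tensor_map I \<Delta> t) = slice_right (convolution \<Delta> \<phi> \<psi>) t" for t
    by (induction t rule: tensor_induct)
       (simp_all add: map_right clinear_add[OF clinear_tensor_map[OF I \<Delta>]]
        clinear_add[OF P] clinear_add[OF clinear_slice_right[OF conv]] slice_right_elem conv
        clinear_functional_tensor l, simp add: convolution_def)
  moreover have "?P (tensor_assoc (tensor_map \<Delta> I t)) = slice_right \<phi> (\<Delta> (slice_right \<psi> t))" for t
    by (induction t rule: tensor_induct)
       (simp_all add: map_left clinear_add[OF clinear_tensor_map[OF \<Delta> I]]
        clinear_add[OF P] clinear_add[OF clinear_slice_right[OF l(1)]]
        clinear_add[OF clinear_slice_right[OF l(2)]] slice_right_elem[OF l(2)]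
        clinear_add[OF clinear_tensor_assoc] tensor_assoc_elem_right app clinear_add[OF \<Delta>]
        clinear_scaleC[OF \<Delta>] clinear_scaleC[OF clinear_slice_right[OF l(1)]])
  ultimately show ?thesis using co by (metis coassociative_def I_def)
qed

text \<open>Now the first two legs are evaluated, and the order of convolution is reversed.\<close>

lemma slice_left_slice_left_coassociative:
  assumes hom: "star_hom (\<Delta> :: 'a::cstar_algebra \<Rightarrow> ('a, 'a) tensor)" and co: "coassociative \<Delta>" and l: "clinear \<phi>" "clinear \<psi>"
  shows "slice_left \<phi> (\<Delta> (slice_left \<psi> (\<Delta> a))) = slice_left (convolution \<Delta> \<psi> \<phi>) (\<Delta> a)"
proof -
  note \<Delta> = star_homD(1)[OF hom]
  have conv: "clinear (convolution \<Delta> \<psi> \<phi>)"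
    unfolding convolution_def o_def by (intro clinear_compose[OF \<Delta>] clinear_functional_tensor l)
  let ?P = "\<lambda>t. slice_left \<phi> (slice_left \<psi> t)"
  have P: "clinear ?P" by (intro clinear_compose[OF clinear_slice_left] clinear_slice_left l)
  define I where "I = (id :: 'a \<Rightarrow> 'a)"
  have I: "clinear I" by (intro clinearI) (auto simp: I_def)
  have map_right: "tensor_map I \<Delta> (a \<otimes> b) = a \<otimes> \<Delta> b" for a b
    using tensor_map_elem[OF I \<Delta>, of a b] by (simp add: I_def)
  have map_left: "tensor_map \<Delta> I (a \<otimes> b) = \<Delta> a \<otimes> b" for a b
    using tensor_map_elem[OF \<Delta> I, of a b] by (simp add: I_def)
  have app: "?P (append_tensor b s) = functional_tensor \<psi> \<phi> s *\<^sub>C b" for b and s :: "('a, 'a) tensor"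
    by (induction s rule: tensor_induct)
       (simp_all add: append_tensor_elem append_tensor_add clinear_add[OF P] l slice_left_elem
        functional_tensor_elem clinear_scaleC[OF clinear_slice_left[OF l(1)]]
        clinear_add[OF clinear_functional_tensor] scaleC_add_left)
  have "?P (tensor_map I \<Delta> t) = slice_left \<phi> (\<Delta> (slice_left \<psi> t))" for t
    by (induction t rule: tensor_induct)
       (simp_all add: map_right clinear_add[OF clinear_tensor_map[OF I \<Delta>]]
        clinear_add[OF clinear_slice_left] slice_left_elem l clinear_add[OF \<Delta>] clinear_scaleC[OF \<Delta>])
  moreover have "?P (tensor_assoc (tensor_map \<Delta> I t)) = slice_left (convolution \<Delta> \<psi> \<phi>) t" for t
    by (induction t rule: tensor_induct)
       (simp_all add: map_left clinear_add[OF clinear_tensor_map[OF \<Delta> I]]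
        clinear_add[OF P] clinear_add[OF clinear_slice_left[OF conv]] slice_left_elem[OF conv]
        clinear_add[OF clinear_tensor_assoc] tensor_assoc_elem_right app, simp add: convolution_def)
  ultimately show ?thesis using co by (metis coassociative_def I_def)
qed

text \<open>The conjugated functional \<open>\<eta>\<close> is again a left counit, and a left
  counit agrees with the right counit \<open>\<epsilon>\<close>: evaluate \<eta> \<otimes>
  \<epsilon> on \<open>\<Delta> x\<close> in both orders.\<close>

lemma counit_star:
  assumes hom: "star_hom \<Delta>" and eps: "counit \<Delta> \<epsilon>"
  shows "\<epsilon> (star a) = cnj (\<epsilon> a)"
proof -
  have \<epsilon>: "clinear \<epsilon>" "\<And>a. slice_right \<epsilon> (\<Delta> a) = a" "\<And>a. slice_left \<epsilon> (\<Delta> a) = a"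
    using eps by (simp_all add: counit_def character_def)
  define \<eta> where "\<eta> y = cnj (\<epsilon> (star y))" for y
  have \<eta>: "clinear \<eta>" unfolding \<eta>_def by (rule clinear_cnj_star[OF \<epsilon>(1)])
  have "star (slice_left \<eta> (\<Delta> x)) = star x" for x
    using slice_left_star[OF \<epsilon>(1), of "\<Delta> x"] \<epsilon>(3)[of "star x"]
    by (simp add: \<eta>_def[abs_def] star_homD(4)[OF hom])
  then have "slice_left \<eta> (\<Delta> x) = x" for x by (metis star_star)
  then have "\<eta> x = \<epsilon> x" for x
    using functional_tensor_slice_left[OF \<eta> \<epsilon>(1), of "\<Delta> x"]
      functional_tensor_slice_right[OF \<eta> \<epsilon>(1), of "\<Delta> x"] by (simp add: \<epsilon>)
  then show ?thesis by (metis \<eta>_def complex_cnj_cnj)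
qed

lemma positive_square_eq: "0 < a \<Longrightarrow> 0 < b \<Longrightarrow> a * a = b * b \<Longrightarrow> a = (b :: complex)"
  by (auto simp: square_eq_iff less_complex_def)

text \<open>The counit, Haar and coassociativity axioms in the form that is symmetric under flipping the
  comultiplication, so that every result about right slices has a mirror image.\<close>

locale faithful_haar =
  fixes \<Delta> :: "'a::cstar_algebra \<Rightarrow> ('a, 'a) tensor" and \<epsilon> h :: "'a \<Rightarrow> complex"
  assumes comult: "star_hom \<Delta>"
    and finite_dim: "\<exists>B :: 'a set. finite B \<and> complex_vector.span B = UNIV"
    and slice_right_coassoc: "clinear \<phi> \<Longrightarrow> clinear \<psi> \<Longrightarrow>
      slice_right \<phi> (\<Delta> (slice_right \<psi> (\<Delta> a))) = slice_right (convolution \<Delta> \<phi> \<psi>) (\<Delta> a)"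
    and slice_left_coassoc: "clinear \<phi> \<Longrightarrow> clinear \<psi> \<Longrightarrow>
      slice_left \<phi> (\<Delta> (slice_left \<psi> (\<Delta> a))) = slice_left (convolution \<Delta> \<psi> \<phi>) (\<Delta> a)"
    and eps_linear: "clinear \<epsilon>" and eps_mult: "\<epsilon> (a * b) = \<epsilon> a * \<epsilon> b"
    and eps_star: "\<epsilon> (star a) = cnj (\<epsilon> a)"
    and eps_left: "slice_left \<epsilon> (\<Delta> a) = a" and eps_right: "slice_right \<epsilon> (\<Delta> a) = a"
    and haar: "haar_state \<Delta> h" and faithful: "h (star a * a) = 0 \<Longrightarrow> a = 0"
begin

lemma convolution_flip:
  "clinear \<phi> \<Longrightarrow> clinear \<psi> \<Longrightarrow> convolution (flip \<circ> \<Delta>) \<phi> \<psi> = convolution \<Delta> \<psi> \<phi>"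
  by (simp add: convolution_def fun_eq_iff functional_tensor_flip)

lemma clinear_convolution: "clinear \<phi> \<Longrightarrow> clinear \<psi> \<Longrightarrow> clinear (convolution \<Delta> \<phi> \<psi>)"
  unfolding convolution_def o_def
  by (intro clinear_compose[OF star_homD(1)[OF comult]] clinear_functional_tensor)

text \<open>The flip exchanges the left and right assumptions and reverses convolution, matching the
  two coassociativity conditions with each other.\<close>

lemma opposite: "faithful_haar (flip \<circ> \<Delta>) \<epsilon> h"
  by (rule faithful_haar.intro)
     (use haar in \<open>simp_all add: star_hom_flip comult finite_dim slice_right_flip slice_left_flip
       slice_right_coassoc slice_left_coassoc convolution_flip clinear_convolution
       eps_linear eps_mult eps_star eps_left eps_right faithful haar_state_def state_def\<close>)

lemmas comult_linear = star_homD(1)[OF comult]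
  and comult_mult = star_homD(2)[OF comult]
  and comult_star = star_homD(4)[OF comult]

lemma haar_positive: "positive_functional h" and haar_linear: "clinear h"
  and slice_left_haar: "slice_left h (\<Delta> a) = h a *\<^sub>C 1"
  using haar by (simp_all add: haar_state_def state_def positive_functional_def)

lemma eq_if_haar_eq:
  assumes "\<And>a. h (star a * x) = h (star a * y)"
  shows "x = y"
proof -
  have "h (star (x - y) * (x - y)) = 0"
    using assms[of "x - y"] by (simp only: right_diff_distrib clinear_diff[OF haar_linear]) simp
  then show ?thesis using faithful by fastforce
qed

lemma density_eq:
  assumes "\<And>a. h (star x * a) = h (star y * a)"
  shows "x = y"
proof (rule eq_if_haar_eq)
  fix a
  show "h (star a * x) = h (star a * y)"
    using assms[of a] positive_functional_sesq_cnj[OF haar_positive, of a] by metis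
qed

lemma tensor_positive:
  assumes "positive_functional \<phi>" "positive_functional \<psi>"
  shows "positive_functional (functional_tensor \<phi> (\<psi> :: 'a \<Rightarrow> complex))"
  using finite_dim positive_functional_tensor[OF assms] by blast

lemma tensor_faithful: "functional_tensor h h (star t * t) = 0 \<Longrightarrow> t = 0"
  using finite_dim functional_tensor_faithful[OF haar_positive faithful haar_positive faithful]
  by blast

section \<open>Slices by a state as operators on the GNS space\<close>

text \<open>For a state \<open>\<phi>\<close> this makes \<open>\<Delta>\<close> isometric from the
  seminorm of \<open>h\<close> to that of h \<otimes> \<phi>.\<close>

lemma haar_tensor_comult:
  assumes "clinear \<phi>"
  shows "functional_tensor h \<phi> (\<Delta> a) = h a * \<phi> 1"
  by (simp add: functional_tensor_slice_left haar_linear assms slice_left_haar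
      clinear_complex_scaleC)

text \<open>Positive functionals are Hermitian, so the slice map commutes with \<open>star\<close>
  and its fixed points are closed under it.\<close>

lemma slice_right_comult_star:
  assumes "positive_functional \<phi>" "slice_right \<phi> (\<Delta> a) = a"
  shows "slice_right \<phi> (\<Delta> (star a)) = star a"
  using slice_right_star[OF positive_functionalD(1)[OF assms(1)], of "\<Delta> a"] assms
  by (simp add: comult_star positive_functional_cnj_star)

text \<open>The slice map \<open>T = (id \<otimes> \<phi>)\<Delta>\<close> is a contraction of the GNS space, so fixed points \<open>a\<close> of \<open>T\<close>
  are those for which equality holds in the Cauchy--Schwarz estimate of
  \<open>\<langle>\<Delta>(a), a \<otimes> 1\<rangle>\<close>.\<close>

lemma slice_fixed_null:
  assumes \<phi>: "state \<phi>" and fixed: "slice_right \<phi> (\<Delta> a) = a"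
  shows "functional_tensor h \<phi> (s * (\<Delta> a - a \<otimes> 1)) = 0"
proof -
  note pos = state_positive_functional[OF \<phi>]
  note l = positive_functionalD(1)[OF pos]
  let ?F = "functional_tensor h \<phi>" and ?u = "\<Delta> a - a \<otimes> 1"
  have F: "positive_functional ?F" by (rule tensor_positive[OF haar_positive pos])
  note Fl = positive_functionalD(1)[OF F]
  have star_u: "star ?u = \<Delta> (star a) - star a \<otimes> 1"
    by (simp add: star_diff comult_star star_elem)
  have "?F (\<Delta> (star a) * \<Delta> a) = h (star a * a)"
    using haar_tensor_comult[OF l, of "star a * a"] by (simp add: comult_mult state_one[OF \<phi>])
  moreover have "?F (\<Delta> (star a) * (a \<otimes> 1)) = h (star a * a)"
    by (simp add: functional_tensor_slice_right haar_linear l slice_right_mult_right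
        slice_right_comult_star[OF pos fixed])
  moreover have "?F ((star a \<otimes> 1) * \<Delta> a) = h (star a * a)"
    by (simp add: functional_tensor_slice_right haar_linear l slice_right_mult_left fixed)
  moreover have "?F ((star a \<otimes> 1) * (a \<otimes> 1)) = h (star a * a)"
    by (simp add: times_elem functional_tensor_elem haar_linear l state_one[OF \<phi>])
  ultimately have "?F (star ?u * ?u) = 0"
    by (simp add: star_u left_diff_distrib right_diff_distrib clinear_diff[OF Fl])
  from positive_functional_null[OF F this, of "star s"] show ?thesis by simp
qed

text \<open>Pair \<open>\<Delta> b\<close> with \<open>\<Delta> c\<close> and with
  \<open>c \<otimes> 1\<close>; the two pairings agree because the difference of the latter two is a
  null vector. It plays the part of self-adjointness of T against fixed vectors.\<close>

lemma haar_slice_fixed: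
  assumes \<phi>: "state \<phi>" and fixed: "slice_right \<phi> (\<Delta> c) = c"
  shows "h (star b * c) = h (star (slice_right \<phi> (\<Delta> b)) * c)"
proof -
  note pos = state_positive_functional[OF \<phi>]
  note l = positive_functionalD(1)[OF pos]
  let ?F = "functional_tensor h \<phi>"
  have Fl: "clinear ?F" by (intro clinear_functional_tensor haar_linear l)
  have "?F (\<Delta> (star b) * \<Delta> c) = h (star b * c)"
    using haar_tensor_comult[OF l, of "star b * c"] by (simp add: comult_mult state_one[OF \<phi>])
  moreover have "?F (\<Delta> (star b) * (c \<otimes> 1)) = h (star (slice_right \<phi> (\<Delta> b)) * c)"
    by (simp add: functional_tensor_slice_right haar_linear l slice_right_mult_right comult_star
        slice_right_star positive_functional_cnj_star[OF pos])
  ultimately show ?thesis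
    using slice_fixed_null[OF assms, of "\<Delta> (star b)"]
    by (simp add: right_diff_distrib clinear_diff[OF Fl])
qed

text \<open>Convolving with \<open>\<phi>\<close> on the right composes \<open>\<theta>\<close> with
  T. Since T is an orthogonal projection, invariance of \<open>\<theta>\<close> under this means
  that its density lies in the range of T.\<close>

lemma convolution_eq_iff_slice_fixed:
  assumes \<phi>: "idempotent_state \<Delta> \<phi>" and \<theta>: "clinear \<theta>" "\<And>a. \<theta> a = h (star x * a)"
  shows "convolution \<Delta> \<theta> \<phi> = \<theta> \<longleftrightarrow> slice_right \<phi> (\<Delta> x) = x"
proof -
  have st: "state \<phi>" and idem: "convolution \<Delta> \<phi> \<phi> = \<phi>"
    using \<phi> by (simp_all add: idempotent_state_def)
  have l: "clinear \<phi>" using st by (simp add: state_def)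
  define T where "T a = slice_right \<phi> (\<Delta> a)" for a
  have TT: "slice_right \<phi> (\<Delta> (T a)) = T a" for a
    using slice_right_coassoc[OF l l, of a] by (simp add: idem T_def)
  have conv: "convolution \<Delta> \<theta> \<phi> a = h (star x * T a)" for a
    by (simp add: convolution_def functional_tensor_slice_right \<theta>(1) l T_def) (rule \<theta>(2))
  note cnj_h = positive_functional_sesq_cnj[OF haar_positive]
  show ?thesis
  proof
    assume "slice_right \<phi> (\<Delta> x) = x"
    then have "h (star b * x) = h (star (T b) * x)" for b
      unfolding T_def by (rule haar_slice_fixed[OF st])
    then have "h (star x * b) = h (star x * T b)" for b
      by (metis cnj_h)
    then show "convolution \<Delta> \<theta> \<phi> = \<theta>" by (simp add: fun_eq_iff conv \<theta>(2))
  next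
    assume "convolution \<Delta> \<theta> \<phi> = \<theta>"
    then have eq: "h (star x * T b) = h (star x * b)" for b by (metis conv \<theta>(2))
    \<comment> \<open>Both the pairing of \<open>T x\<close> with \<open>b\<close> and that of
      \<open>x\<close> with \<open>T b\<close> equal the pairing of \<open>T x\<close> with
      \<open>T b\<close>.\<close>
    have "h (star (T x) * b) = h (star x * b)" for b
    proof -
      have "h (star b * T x) = h (star (T b) * T x)"
        by (rule haar_slice_fixed[OF st TT, of b x, folded T_def])
      then have "h (star (T x) * b) = h (star (T x) * T b)" by (metis cnj_h)
      also have "\<dots> = h (star x * T b)"
        by (rule haar_slice_fixed[OF st TT, of x b, folded T_def, symmetric])
      finally show ?thesis by (simp add: eq)
    qed
    then show "slice_right \<phi> (\<Delta> x) = x" unfolding T_def[symmetric] by (rule density_eq)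
  qed
qed

section \<open>Vector functionals and pre-subgroups\<close>

lemma vector_functional_eq: "vector_functional h g a = h (star g * (a * g))"
  by (simp add: vector_functional_def gns_inner_def)

lemma state_vector_functional:
  assumes "h (star g * g) = 1"
  shows "state (vector_functional h g)"
  using positive_functional_cmult_left[OF haar_positive, of g] assms
  by (simp add: state_def positive_functional_def vector_functional_eq[abs_def])

lemma functional_tensor_vector_functional:
  "functional_tensor (vector_functional h f) (vector_functional h g) t
    = functional_tensor h h (star (f \<otimes> g) * (t * (f \<otimes> g)))"
proof -
  have "clinear (vector_functional h k)" for k
    unfolding vector_functional_eq[abs_def]
    by (intro clinear_compose[OF clinear_mult_right] clinear_compose[OF clinear_mult_left] haar_linear)
  then show ?thesis
    by (induction t rule: tensor_induct)
       (simp_all add: functional_tensor_elem haar_linear times_elem star_elem vector_functional_eq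
         distrib_left distrib_right clinear_add[OF clinear_functional_tensor])
qed

lemma functional_tensor_haar_vector_functional:
  "functional_tensor h (vector_functional h g) t
    = functional_tensor h h (star (1 \<otimes> g) * (t * (1 \<otimes> g)))"
proof -
  have "vector_functional h 1 = h" by (simp add: vector_functional_eq[abs_def])
  then show ?thesis using functional_tensor_vector_functional[of 1 g t] by simp
qed

text \<open>A fixed point makes \<open>(\<Delta> a - a \<otimes> 1) * (1 \<otimes> g)\<close> null
  for the faithful functional h \<otimes> h. Conversely, pair the second leg with \<open>g\<close>
  and use its unit norm.\<close>

lemma slice_fixed_iff:
  assumes g: "h (star g * g) = 1"
  shows "slice_right (vector_functional h g) (\<Delta> a) = a \<longleftrightarrow> \<Delta> a * (1 \<otimes> g) = a \<otimes> g"
proof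
  let ?\<omega> = "vector_functional h g"
  assume fixed: "slice_right ?\<omega> (\<Delta> a) = a"
  let ?u = "\<Delta> a - a \<otimes> 1"
  have "functional_tensor h ?\<omega> (star ?u * ?u) = 0"
    by (rule slice_fixed_null[OF state_vector_functional[OF g] fixed])
  then have "functional_tensor h h (star (?u * (1 \<otimes> g)) * (?u * (1 \<otimes> g))) = 0"
    by (simp add: functional_tensor_haar_vector_functional star_mult mult.assoc)
  then have "?u * (1 \<otimes> g) = 0" by (rule tensor_faithful)
  then show "\<Delta> a * (1 \<otimes> g) = a \<otimes> g" by (simp add: left_diff_distrib times_elem)
next
  assume eq: "\<Delta> a * (1 \<otimes> g) = a \<otimes> g"
  have l: "clinear (\<lambda>y. h (star g * y))"
    by (intro clinear_compose[OF clinear_mult_left] haar_linear)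
  have "slice_right (vector_functional h g) (\<Delta> a) = slice_right h ((1 \<otimes> star g) * (\<Delta> a * (1 \<otimes> g)))"
    by (simp add: slice_right_mult_left[OF haar_linear] slice_right_mult_right[OF l]
        vector_functional_eq[abs_def])
  also have "\<dots> = a" by (simp add: eq times_elem slice_right_elem haar_linear g)
  finally show "slice_right (vector_functional h g) (\<Delta> a) = a" .
qed

text \<open>The counit on the first leg reduces the tensor equation to an eigenvector equation in
  the algebra.\<close>

lemma slice_left_eps_fixed:
  assumes "\<Delta> a * (1 \<otimes> g) = a \<otimes> g"
  shows "a * g = \<epsilon> a *\<^sub>C g"
  using arg_cong[OF assms, of "slice_left \<epsilon>"]
  by (simp add: slice_left_mult_right slice_left_elem eps_linear eps_left)

lemma pre_subgroup_iff:
  "pre_subgroup \<Delta> h \<epsilon> f \<longleftrightarrow> h (star f * f) = 1 \<and> 0 < \<epsilon> f \<and> \<Delta> f * (1 \<otimes> f) = f \<otimes> f"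
  by (simp add: pre_subgroup_def gns_inner_def multiplicative_unitary_elem comult_linear)

lemma pre_subgroup_le_iff: "pre_subgroup_le \<Delta> g f \<longleftrightarrow> \<Delta> f * (1 \<otimes> g) = f \<otimes> g"
  by (simp add: pre_subgroup_le_def multiplicative_unitary_elem comult_linear)

lemma idempotent_vector_functional:
  assumes f: "pre_subgroup \<Delta> h \<epsilon> f"
  shows "idempotent_state \<Delta> (vector_functional h f)"
proof -
  let ?\<omega> = "vector_functional h f"
  have n: "h (star f * f) = 1" and inv: "f \<otimes> f = \<Delta> f * (1 \<otimes> f)"
    using f by (simp_all add: pre_subgroup_iff)
  have st: "state ?\<omega>" by (rule state_vector_functional[OF n])
  have "convolution \<Delta> ?\<omega> ?\<omega> a = ?\<omega> a" for a
  proof -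
    have "convolution \<Delta> ?\<omega> ?\<omega> a = functional_tensor h h (star (f \<otimes> f) * (\<Delta> a * (f \<otimes> f)))"
      by (simp add: convolution_def functional_tensor_vector_functional)
    \<comment> \<open>Substituting \<open>\<Delta> f * (1 \<otimes> f)\<close> for both copies of
      \<open>f \<otimes> f\<close> gathers the first factors into a single comultiplication, to
      which invariance of \<open>h\<close> applies.\<close>
    also have "star (f \<otimes> f) * (\<Delta> a * (f \<otimes> f))
        = star (1 \<otimes> f) * (\<Delta> (star f * (a * f)) * (1 \<otimes> f))"
      by (simp add: inv star_mult comult_mult comult_star mult.assoc)
    also have "functional_tensor h h \<dots> = functional_tensor h ?\<omega> (\<Delta> (star f * (a * f)))"
      by (simp add: functional_tensor_haar_vector_functional)
    also have "\<dots> = ?\<omega> a"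
      using haar_tensor_comult[of ?\<omega>] st by (simp add: state_def vector_functional_eq)
    finally show ?thesis .
  qed
  with st show ?thesis by (simp add: idempotent_state_def fun_eq_iff)
qed

text \<open>With \<open>f\<close> also \<open>star f\<close> is a fixed point of the slice by its
  vector functional. The counit then gives \<open>star f * f = \<epsilon> f *\<^sub>C f\<close>,
  whose left side is self-adjoint.\<close>

lemma pre_subgroup_self_adjoint:
  assumes f: "pre_subgroup \<Delta> h \<epsilon> f"
  shows "star f = f"
proof -
  have n: "h (star f * f) = 1" and e: "0 < \<epsilon> f" and inv: "\<Delta> f * (1 \<otimes> f) = f \<otimes> f"
    using f by (simp_all add: pre_subgroup_iff)
  have pos: "positive_functional (vector_functional h f)"
    by (intro state_positive_functional state_vector_functional n)
  have "\<Delta> (star f) * (1 \<otimes> f) = star f \<otimes> f"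
    using slice_right_comult_star[OF pos] inv unfolding slice_fixed_iff[OF n, symmetric] by blast
  from slice_left_eps_fixed[OF this] have ff: "star f * f = cnj (\<epsilon> f) *\<^sub>C f" by (simp add: eps_star)
  have real: "cnj (\<epsilon> f) = \<epsilon> f" using e by (simp add: less_complex_def complex_eq_iff)
  have "\<epsilon> f *\<^sub>C f = star (star f * f)" unfolding star_mult star_star by (simp add: ff real)
  also have "\<dots> = \<epsilon> f *\<^sub>C star f" unfolding ff by (simp add: star_scaleC real)
  finally show ?thesis using e by auto
qed

lemma positive_multiples_eq:
  assumes "0 < \<epsilon> f" "0 < \<epsilon> g" "\<epsilon> f *\<^sub>C f = \<epsilon> g *\<^sub>C g"
  shows "f = g"
proof -
  have "\<epsilon> f * \<epsilon> f = \<epsilon> g * \<epsilon> g"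
    using arg_cong[OF assms(3), of \<epsilon>] by (simp add: clinear_complex_scaleC[OF eps_linear])
  then have "\<epsilon> f = \<epsilon> g" by (rule positive_square_eq[OF assms(1,2)])
  then show ?thesis using assms by auto
qed

text \<open>Equal functionals have equal fixed points, so the counit gives
  \<open>f * g = \<epsilon> f *\<^sub>C g\<close> and
  \<open>g * f = \<epsilon> g *\<^sub>C f\<close>. Adjoints make \<open>f\<close> and
  \<open>g\<close> proportional, and unit norm with positivity fixes the factor.\<close>

lemma vector_functional_inj:
  assumes f: "pre_subgroup \<Delta> h \<epsilon> f" and g: "pre_subgroup \<Delta> h \<epsilon> g"
    and eq: "vector_functional h f = vector_functional h g"
  shows "f = g"
proof -
  have f': "h (star f * f) = 1" "0 < \<epsilon> f" "\<Delta> f * (1 \<otimes> f) = f \<otimes> f"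
    and g': "h (star g * g) = 1" "0 < \<epsilon> g" "\<Delta> g * (1 \<otimes> g) = g \<otimes> g"
    using f g by (simp_all add: pre_subgroup_iff)
  have "\<Delta> f * (1 \<otimes> g) = f \<otimes> g" "\<Delta> g * (1 \<otimes> f) = g \<otimes> f"
    using f' g' eq slice_fixed_iff by metis+
  then have fg: "f * g = \<epsilon> f *\<^sub>C g" and gf: "g * f = \<epsilon> g *\<^sub>C f"
    by (simp_all add: slice_left_eps_fixed)
  have real: "cnj (\<epsilon> f) = \<epsilon> f" and real': "cnj (\<epsilon> g) = \<epsilon> g"
    using f' g' by (simp_all add: less_complex_def complex_eq_iff)
  have "g * f = star (f * g)"
    by (simp add: star_mult pre_subgroup_self_adjoint f g del: fg)
  also have "\<dots> = \<epsilon> f *\<^sub>C g" by (simp add: fg star_scaleC real pre_subgroup_self_adjoint g)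
  finally have eq': "\<epsilon> g *\<^sub>C f = \<epsilon> f *\<^sub>C g" by (simp add: gf)
  have "\<epsilon> g * \<epsilon> g = \<epsilon> f * \<epsilon> f"
    using arg_cong[OF eq', of "\<lambda>x. h (star x * x)"] f'(1) g'(1) real
    by (simp add: star_scaleC real' clinear_complex_scaleC[OF haar_linear])
  then have "\<epsilon> g = \<epsilon> f" by (rule positive_square_eq[OF g'(2) f'(2)])
  with eq' f'(2) show ?thesis by auto
qed

text \<open>The pre-subgroup is a multiple of the density \<open>x\<close> of \<open>\<phi>\<close>: idempotence makes \<open>x\<close> a fixed point,
  and then \<open>\<epsilon> \<otimes> id\<close> turns \<open>(h \<otimes> \<phi>)(s(\<Delta>(x) - x \<otimes> 1)) = 0\<close> into
  \<open>\<phi>(cx) = \<epsilon>(x)\<phi>(c)\<close>.\<close>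

lemma idempotent_state_pre_subgroup:
  assumes \<phi>: "idempotent_state \<Delta> \<phi>"
  shows "\<exists>f. pre_subgroup \<Delta> h \<epsilon> f \<and> vector_functional h f = \<phi> \<and> (\<forall>a. \<phi> a = h (star (\<epsilon> f *\<^sub>C f) * a))"
proof -
  have st: "state \<phi>" using \<phi> by (simp add: idempotent_state_def)
  then have l: "clinear \<phi>" by (simp add: state_def)
  obtain B :: "'a set" where B: "finite B" "complex_vector.span B = UNIV" using finite_dim by blast
  obtain x where x: "\<And>a. \<phi> a = h (star x * a)"
    using faithful_functional_representation[OF haar_positive faithful B l] by blast
  have fixed: "slice_right \<phi> (\<Delta> x) = x"
    using convolution_eq_iff_slice_fixed[OF \<phi> l x] \<phi> by (simp add: idempotent_state_def)
  let ?u = "\<Delta> x - x \<otimes> 1"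
  have null: "slice_right \<phi> ((1 \<otimes> c) * ?u) = 0" for c
  proof (rule eq_if_haar_eq)
    fix a
    have l': "clinear (\<lambda>y. \<phi> (c * y))"
      by (intro clinear_compose[OF clinear_mult_left] l)
    have "functional_tensor h \<phi> ((star a \<otimes> c) * ?u) = 0" by (rule slice_fixed_null[OF st fixed])
    then show "h (star a * slice_right \<phi> ((1 \<otimes> c) * ?u)) = h (star a * 0)"
      by (simp add: functional_tensor_slice_right haar_linear l slice_right_mult_left[OF l]
          clinear_zero[OF haar_linear])
  qed
  have mult: "\<phi> (c * x) = \<epsilon> x * \<phi> c" for c
  proof -
    have "\<epsilon> (slice_right \<phi> ((1 \<otimes> c) * ?u)) = \<phi> (slice_left \<epsilon> ((1 \<otimes> c) * ?u))"
      using functional_tensor_slice_right[OF eps_linear l] functional_tensor_slice_left[OF eps_linear l]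
      by metis
    also have "slice_left \<epsilon> ((1 \<otimes> c) * ?u) = c * x - \<epsilon> x *\<^sub>C c"
      by (simp add: right_diff_distrib clinear_diff[OF clinear_slice_left[OF eps_linear]]
          slice_left_mult_left[OF eps_linear] eps_left slice_left_elem eps_linear)
    finally show ?thesis
      by (simp add: null clinear_zero[OF eps_linear] clinear_diff[OF l] clinear_complex_scaleC[OF l])
  qed
  \<comment> \<open>This identifies \<open>\<epsilon> x\<close> with a squared norm, so it is
    positive and has a positive square root.\<close>
  have hx: "h (star x * x) = \<epsilon> x" using mult[of 1] by (simp add: x state_one[OF st] flip: x)
  have "x \<noteq> 0" using x[of 1] state_one[OF st] clinear_zero[OF haar_linear] by auto
  then have "\<epsilon> x \<noteq> 0" "0 \<le> \<epsilon> x"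
    using faithful[of x] positive_functionalD(2)[OF haar_positive, of x] by (auto simp: hx)
  then obtain p where p: "\<epsilon> x = complex_of_real p" "p > 0"
    by (metis complex_is_Real_iff less_eq_complex_def of_real_Re of_real_eq_0_iff order_le_less
        zero_complex.sel)
  \<comment> \<open>With this scaling \<open>\<epsilon> f\<close> is the root of \<open>p\<close>,
    so \<open>\<epsilon> f *\<^sub>C f\<close> is the density \<open>x\<close>; the same factor
    cancels the \<open>\<epsilon> x\<close> in \<open>mult\<close>.\<close>
  define f where "f = complex_of_real (1 / sqrt p) *\<^sub>C x"
  have sq: "complex_of_real (sqrt p) * complex_of_real (sqrt p) = complex_of_real p"
    using p(2) by (simp flip: of_real_mult)
  have ef: "\<epsilon> f = complex_of_real (sqrt p)"
    using p(2) sq by (simp add: f_def clinear_complex_scaleC[OF eps_linear] p(1) divide_simps)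
  have efx: "\<epsilon> f *\<^sub>C f = x" unfolding ef using p(2) by (simp add: f_def)
  have \<omega>: "vector_functional h f c = \<phi> c" for c
  proof -
    have "vector_functional h f c = (1 / complex_of_real (sqrt p)) * (1 / complex_of_real (sqrt p))
        * h (star x * (c * x))"
      by (simp add: vector_functional_eq f_def star_scaleC clinear_complex_scaleC[OF haar_linear])
    also have "\<dots> = \<phi> c"
      using p(2) sq mult[of c] by (simp add: x[symmetric] p(1))
    finally show ?thesis .
  qed
  have n: "h (star f * f) = 1"
    using \<omega>[of 1] by (simp add: vector_functional_eq state_one[OF st])
  have "slice_right (vector_functional h f) (\<Delta> f) = f"
    using fixed \<omega> by (simp add: f_def clinear_scaleC[OF comult_linear]
        clinear_scaleC[OF clinear_slice_right[OF l]] ext[of "vector_functional h _" \<phi>])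
  then have "\<Delta> f * (1 \<otimes> f) = f \<otimes> f" by (simp add: slice_fixed_iff n)
  then have "pre_subgroup \<Delta> h \<epsilon> f"
    using p(2) by (simp add: pre_subgroup_iff n ef less_complex_def)
  then show ?thesis using \<omega> x efx by (intro exI[of _ f]) auto
qed

section \<open>Densities, the opposite comultiplication and the order\<close>

text \<open>The construction from the idempotent state yields a pre-subgroup with this density, and
  injectivity identifies it with \<open>f\<close>.\<close>

lemma vector_functional_density:
  assumes "pre_subgroup \<Delta> h \<epsilon> f"
  shows "vector_functional h f a = h (star (\<epsilon> f *\<^sub>C f) * a)"
  using idempotent_state_pre_subgroup[OF idempotent_vector_functional[OF assms]]
    vector_functional_inj[OF _ assms] by metis

lemma idempotent_state_flip_iff: "idempotent_state (flip \<circ> \<Delta>) \<phi> \<longleftrightarrow> idempotent_state \<Delta> \<phi>"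
  by (auto simp: idempotent_state_def convolution_flip state_def)

text \<open>The vector functional stays idempotent for the flip, hence comes from a flipped
  pre-subgroup \<open>g\<close>. Its density is formed without \<open>\<Delta>\<close>, so
  \<open>\<epsilon> g *\<^sub>C g\<close> equals \<open>\<epsilon> f *\<^sub>C f\<close> and
  \<open>g = f\<close>.\<close>

lemma pre_subgroup_flip:
  assumes f: "pre_subgroup \<Delta> h \<epsilon> f"
  shows "pre_subgroup (flip \<circ> \<Delta>) h \<epsilon> f"
proof -
  interpret op: faithful_haar "flip \<circ> \<Delta>" \<epsilon> h by (rule opposite)
  have "idempotent_state (flip \<circ> \<Delta>) (vector_functional h f)"
    using idempotent_vector_functional[OF f] by (simp add: idempotent_state_flip_iff)
  then obtain g where g: "pre_subgroup (flip \<circ> \<Delta>) h \<epsilon> g"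
    "\<And>a. vector_functional h f a = h (star (\<epsilon> g *\<^sub>C g) * a)"
    using op.idempotent_state_pre_subgroup by metis
  then have "\<epsilon> f *\<^sub>C f = \<epsilon> g *\<^sub>C g"
    by (intro density_eq) (simp only: vector_functional_density[OF f, symmetric])
  then have "f = g"
    by (rule positive_multiples_eq[rotated 2]) (use f g(1) in \<open>simp_all add: pre_subgroup_def\<close>)
  then show ?thesis using g(1) by simp
qed

lemma pre_subgroup_mult_iff:
  assumes f: "pre_subgroup \<Delta> h \<epsilon> f" and g: "pre_subgroup \<Delta> h \<epsilon> g"
  shows "\<Delta> f * (1 \<otimes> g) = f \<otimes> g \<longleftrightarrow> f * g = \<epsilon> f *\<^sub>C g"
proof
  assume fg: "f * g = \<epsilon> f *\<^sub>C g"
  have f': "0 < \<epsilon> f" "\<Delta> f * (1 \<otimes> f) = f \<otimes> f" using f by (simp_all add: pre_subgroup_iff)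
  \<comment> \<open>Writing \<open>\<epsilon> f *\<^sub>C g\<close> as \<open>f * g\<close> brings
    in the factor \<open>1 \<otimes> f\<close> that \<open>\<Delta> f\<close> absorbs.\<close>
  have "\<epsilon> f *\<^sub>C (\<Delta> f * (1 \<otimes> g)) = \<Delta> f * (1 \<otimes> f) * (1 \<otimes> g)"
    by (simp add: mult.assoc times_elem fg elem_tensor_scaleC_right)
  also have "\<dots> = \<epsilon> f *\<^sub>C (f \<otimes> g)" by (simp add: f' times_elem fg elem_tensor_scaleC_right)
  finally show "\<Delta> f * (1 \<otimes> g) = f \<otimes> g" using f'(1) by auto
qed (rule slice_left_eps_fixed)

text \<open>The density of the functional of \<open>f\<close> is a nonzero multiple of
  \<open>f\<close>, so the criterion for densities applies to \<open>f\<close> itself. The order of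
  convolution here is opposite to that in \<open>idempotent_state_le\<close>.\<close>

lemma pre_subgroup_convolution_iff:
  assumes f: "pre_subgroup \<Delta> h \<epsilon> f" and g: "pre_subgroup \<Delta> h \<epsilon> g"
  shows "convolution \<Delta> (vector_functional h f) (vector_functional h g) = vector_functional h f
    \<longleftrightarrow> f * g = \<epsilon> f *\<^sub>C g"
proof -
  let ?\<omega> = "vector_functional h g"
  have e: "\<epsilon> f \<noteq> 0" and n: "h (star g * g) = 1" using f g by (auto simp: pre_subgroup_iff)
  have l: "clinear ?\<omega>" "clinear (vector_functional h f)"
    using f g by (auto simp: pre_subgroup_iff dest!: state_vector_functional simp: state_def)
  have "convolution \<Delta> (vector_functional h f) ?\<omega> = vector_functional h f
      \<longleftrightarrow> slice_right ?\<omega> (\<Delta> (\<epsilon> f *\<^sub>C f)) = \<epsilon> f *\<^sub>C f"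
    by (rule convolution_eq_iff_slice_fixed[OF idempotent_vector_functional[OF g] l(2)
          vector_functional_density[OF f]])
  also have "\<dots> \<longleftrightarrow> slice_right ?\<omega> (\<Delta> f) = f"
    using e by (simp add: clinear_scaleC[OF comult_linear] clinear_scaleC[OF clinear_slice_right[OF l(1)]])
  finally show ?thesis using n pre_subgroup_mult_iff[OF f g] by (simp add: slice_fixed_iff)
qed

text \<open>The criterion \<open>f * g = \<epsilon> f *\<^sub>C g\<close> does not mention the
  comultiplication. Reading it for \<open>\<Delta>\<close> on one side and for the flip on the other
  reverses the convolution as required.\<close>

lemma pre_subgroup_le_iff_convolution:
  assumes f: "pre_subgroup \<Delta> h \<epsilon> f" and g: "pre_subgroup \<Delta> h \<epsilon> g"
  shows "pre_subgroup_le \<Delta> g f \<longleftrightarrow>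
    idempotent_state_le \<Delta> (vector_functional h g) (vector_functional h f)"
proof -
  interpret op: faithful_haar "flip \<circ> \<Delta>" \<epsilon> h by (rule opposite)
  have l: "clinear (vector_functional h f)" "clinear (vector_functional h g)"
    using f g by (auto simp: pre_subgroup_iff dest!: state_vector_functional simp: state_def)
  show ?thesis
    using op.pre_subgroup_convolution_iff[OF pre_subgroup_flip[OF f] pre_subgroup_flip[OF g]]
      pre_subgroup_mult_iff[OF f g]
    by (simp add: pre_subgroup_le_iff idempotent_state_le_def convolution_flip l)
qed

lemma vector_functional_bij_betw:
  "bij_betw (vector_functional h) {f. pre_subgroup \<Delta> h \<epsilon> f} {\<phi>. idempotent_state \<Delta> \<phi>}"
proof (rule bij_betwI')
  show "\<exists>f\<in>{f. pre_subgroup \<Delta> h \<epsilon> f}. \<phi> = vector_functional h f"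
    if "\<phi> \<in> {\<phi>. idempotent_state \<Delta> \<phi>}" for \<phi>
    using that idempotent_state_pre_subgroup[of \<phi>] by auto
qed (auto intro: vector_functional_inj idempotent_vector_functional)

end

theorem theorem3p2:
  fixes \<Delta> :: "'a::cstar_algebra \<Rightarrow> ('a, 'a) tensor"
    and \<epsilon> h :: "'a \<Rightarrow> complex"
  assumes "finite_quantum_group \<Delta>"
    and "counit \<Delta> \<epsilon>"
    and "haar_state \<Delta> h"
  shows "bij_betw (vector_functional h) {f. pre_subgroup \<Delta> h \<epsilon> f} {\<phi>. idempotent_state \<Delta> \<phi>}
    \<and> (\<forall>f g. pre_subgroup \<Delta> h \<epsilon> f \<longrightarrow> pre_subgroup \<Delta> h \<epsilon> g \<longrightarrow>
          (pre_subgroup_le \<Delta> g f \<longleftrightarrow>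
           idempotent_state_le \<Delta> (vector_functional h g) (vector_functional h f)))"
proof -
  have hom: "star_hom \<Delta>" and co: "coassociative \<Delta>"
    and fin: "\<exists>B :: 'a set. finite B \<and> complex_vector.span B = UNIV"
    using assms(1) by (simp_all add: finite_quantum_group_def)
  interpret faithful_haar \<Delta> \<epsilon> h
  proof (rule faithful_haar.intro)
    show "\<epsilon> (star a) = cnj (\<epsilon> a)" for a by (rule counit_star[OF hom assms(2)])
    show "a = 0" if "h (star a * a) = 0" for a by (rule haar_state_faithful[OF assms that])
  qed (use assms(2,3) fin in \<open>auto simp: counit_def character_def hom
      slice_right_slice_right_coassociative[OF hom co] slice_left_slice_left_coassociative[OF hom co]\<close>)
  show ?thesis using vector_functional_bij_betw pre_subgroup_le_iff_convolution by blast
qed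

end
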